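(* Let $\varepsilon=0.3748\cdots$ be the unique positive solution of the equation $(1+x)e^x=2$, and set $a=\big(2\varepsilon(2-e^{\varepsilon})/9\big)^{1/3}=0.3567\cdots$. There exists an explicit constant $C>0$ such that for every integer $n\geq 1$ and every transcendental real number $\xi$, one has $\widehat{\omega}_n(\xi)\leq 2n-a n^{1/3}+C$.
   Context: For a polynomial $P\in\mathbb{R}[X]$, $H(P)$ denotes the largest absolute value of its coefficients; $\mathbb{Z}[X]_{\leq n}$ denotes the integer polynomials of degree at most $n$. For a real number $\xi$ and integer $n\geq1$, $\widehat{\omega}_n(\xi)$ is the supremum of the real numbers $\omega>0$ such that for every sufficiently large $H$ the system $H(P)\leq H$, $0<|P(\xi)|\leq H^{-\omega}$ has a solution $P\in\mathbb{Z}[X]_{\leq n}$. *)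

theory Defs
  imports "HOL-Analysis.Analysis" "HOL-Computational_Algebra.Polynomial"
begin

text \<open>Taking the maximum over \<open>{..degree P}\<close> rather than over \<^term>\<open>coeffs P\<close>
  gives the zero polynomial height 0.\<close>

definition poly_height :: "real poly \<Rightarrow> real" where
  "poly_height P = (MAX i\<in>{..degree P}. \<bar>coeff P i\<bar>)"

definition int_polys_upto :: "nat \<Rightarrow> int poly set" where
  "int_polys_upto n = {P. degree P \<le> n}"

text \<open>The supremum is taken in the extended reals, so that it is meaningful without knowing
  beforehand that the admissible exponents are bounded above: an unbounded set has supremum
  \<open>\<infinity>\<close>. The parameter \<open>H\<close> ranges over real numbers.\<close>

definition omega_hat :: "nat \<Rightarrow> real \<Rightarrow> ereal" where
  "omega_hat n \<xi> = Sup {ereal \<omega> | \<omega>. \<omega> > 0 \<and>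
     (\<forall>\<^sub>F H in at_top. \<exists>P \<in> int_polys_upto n.
        poly_height (map_poly real_of_int P) \<le> H \<and>
        0 < \<bar>poly (map_poly real_of_int P) \<xi>\<bar> \<and>
        \<bar>poly (map_poly real_of_int P) \<xi>\<bar> \<le> H powr (- \<omega>))}"

definition eps_const :: real where
  "eps_const = (THE x. x > 0 \<and> (1 + x) * exp x = 2)"

definition a_const :: real where
  "a_const = (2 * eps_const * (2 - exp eps_const) / 9) powr (1/3)"

end

theory Submission
  imports Defs "Jordan_Normal_Form.Char_Poly"
begin

text \<open>
  Suppose that the uniform exponent exceeds \<open>2n - d\<close>, where \<open>22 d\<^sup>3 \<le> n\<close> and \<open>d\<close> is large.

  No polynomial is too small at \<open>\<xi>\<close>: \<open>\<bar>P(\<xi>)\<bar> \<ge> c H(P) powr -(2n + 6d\<^sup>2)\<close>. By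
  multiplicativity it suffices to treat a prime \<open>Q\<close> of large height \<open>X\<close>. If
  \<open>\<bar>Q(\<xi>)\<bar> = X powr -(2n + s)\<close> with \<open>s > 6d\<^sup>2\<close>, then resultants force all good approximations in a range
  of heights above \<open>X\<close> to be multiples \<open>Q S\<close> with \<open>deg S \<le> d + 1\<close>. Up to factors of
  negligible value, these cofactors \<open>S\<close> are powers of one prime \<open>F\<close>. Comparing the cofactor at
  the top of the range with the one just below the height of \<open>F\<^sup>a\<close> bounds the height of \<open>F\<close>,
  and as \<open>a \<le> d + 1\<close>, this bounds \<open>s\<close>.

  Next, the good approximations with heights between \<open>X\<close> and \<open>X powr 1.43\<close> span a space of
  dimension more than \<open>m = \<lceil>2d\<rceil>\<close>. Otherwise two successive spans in a scale of \<open>m\<close> steps coincide,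
  and the pigeonhole principle in this span (in place of Minkowski's theorem) produces a
  polynomial violating the bound above.

  Finally, the multiples of degree at most \<open>2n - m\<close> of \<open>m + 1\<close> independent polynomials of degree
  \<open>n\<close>, two of which are coprime, span all polynomials of degree at most \<open>2n - m\<close>. One obtains
  a nonzero integer determinant in which all but \<open>m - 1\<close> rows are multiples of two coprime
  polynomials of height \<open>X\<close>; its size gives \<open>2n - d \<le> 2(n - m) + 1.43 m + O(1)\<close>, which is false.
  As \<open>a\<^sup>3 < 1/22\<close>, one may take \<open>d = a n powr (1/3)\<close>.
\<close>

section \<open>Heights and values of integer polynomials\<close>

hide_const (open) module.smult

abbreviation rp :: "int poly \<Rightarrow> real poly" where
  "rp \<equiv> map_poly real_of_int"

text \<open>Logarithmic height and order of smallness at \<open>\<xi>\<close>; both are 0 for the zero polynomial, as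
  \<open>ln 0 = 0\<close>.\<close>

definition lh :: "int poly \<Rightarrow> real" where
  "lh P = ln (poly_height (rp P))"

definition lv :: "real \<Rightarrow> int poly \<Rightarrow> real" where
  "lv \<xi> P = - ln \<bar>poly (rp P) \<xi>\<bar>"

interpretation pv: vector_space "smult :: real \<Rightarrow> real poly \<Rightarrow> real poly"
  by unfold_locales (auto simp: smult_add_right smult_add_left)

lemma abs_coeff_le_height: "\<bar>coeff P i\<bar> \<le> poly_height P"
proof (cases "i \<le> degree P")
  case True
  then show ?thesis unfolding poly_height_def by (intro Max_ge) auto
next
  case False
  have "\<bar>coeff P 0\<bar> \<le> poly_height P" unfolding poly_height_def by (intro Max_ge) auto
  with False show ?thesis by (simp add: coeff_eq_0)
qed

lemma height_nonneg [simp]: "poly_height P \<ge> 0"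
  using abs_coeff_le_height[of P 0] by linarith

lemma height_le_iff: "poly_height P \<le> b \<longleftrightarrow> (\<forall>i. \<bar>coeff P i\<bar> \<le> b)"
proof
  assume "\<forall>i. \<bar>coeff P i\<bar> \<le> b"
  then show "poly_height P \<le> b" unfolding poly_height_def by (subst Max_le_iff) auto
qed (use abs_coeff_le_height order_trans in blast)

lemma height_add: "poly_height (P + Q) \<le> poly_height P + poly_height Q"
  unfolding height_le_iff
  by (metis abs_coeff_le_height abs_triangle_ineq add_mono coeff_add order_trans)

lemma height_smult: "poly_height (smult a P) = \<bar>a\<bar> * poly_height P"
proof (rule antisym)
  show "poly_height (smult a P) \<le> \<bar>a\<bar> * poly_height P"
    unfolding height_le_iff by (simp add: abs_mult abs_coeff_le_height mult_left_mono)
  show "\<bar>a\<bar> * poly_height P \<le> poly_height (smult a P)"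
  proof (cases "a = 0")
    case False
    have "poly_height P \<le> poly_height (smult a P) / \<bar>a\<bar>"
      unfolding height_le_iff
    proof
      fix i
      have "\<bar>a\<bar> * \<bar>coeff P i\<bar> \<le> poly_height (smult a P)"
        using abs_coeff_le_height[of "smult a P" i] by (simp add: abs_mult)
      then show "\<bar>coeff P i\<bar> \<le> poly_height (smult a P) / \<bar>a\<bar>"
        using False by (simp add: field_simps)
    qed
    then show ?thesis using False by (simp add: field_simps)
  qed simp
qed

lemma height_eq_0_iff: "poly_height P = 0 \<longleftrightarrow> P = 0"
proof
  assume "poly_height P = 0"
  then have "coeff P i = 0" for i using abs_coeff_le_height[of P i] by simp
  then show "P = 0" by (simp add: poly_eq_iff)
qed (simp add: poly_height_def)

lemma height_monom_mult: "poly_height (monom 1 k * P) = poly_height P"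
proof (rule antisym)
  show "poly_height (monom 1 k * P) \<le> poly_height P"
    unfolding height_le_iff by (auto simp: coeff_monom_mult abs_coeff_le_height)
  show "poly_height P \<le> poly_height (monom 1 k * P)"
    unfolding height_le_iff
  proof
    fix i
    show "\<bar>coeff P i\<bar> \<le> poly_height (monom 1 k * P)"
      using abs_coeff_le_height[of "monom 1 k * P" "i + k"] by (simp add: coeff_monom_mult)
  qed
qed

lemma height_rp_ge_1: assumes "P \<noteq> 0" shows "poly_height (rp P) \<ge> 1"
proof -
  have "\<bar>lead_coeff P\<bar> \<ge> 1" using assms by (simp add: Ints_nonzero_abs_ge1 int_one_le_iff_zero_less)
  then have "1 \<le> real_of_int \<bar>lead_coeff P\<bar>" by linarith
  also have "\<dots> = \<bar>coeff (rp P) (degree P)\<bar>" by (simp add: coeff_map_poly)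
  also have "\<dots> \<le> poly_height (rp P)" by (rule abs_coeff_le_height)
  finally show ?thesis .
qed

lemma lh_nonneg: "P \<noteq> 0 \<Longrightarrow> lh P \<ge> 0"
  using height_rp_ge_1 by (simp add: lh_def)

lemma height_eq_exp_lh: "P \<noteq> 0 \<Longrightarrow> poly_height (rp P) = exp (lh P)"
  using height_rp_ge_1[of P] by (simp add: lh_def)

lemma rp_monom: "rp (monom 1 k) = monom 1 k"
  by (simp add: map_poly_monom)

lemma lh_monom_mult: "lh (monom 1 k * P) = lh P"
  by (simp add: lh_def of_int_poly_hom.hom_mult rp_monom height_monom_mult)

lemma transcendental_rp_nonzero:
  assumes "\<not> algebraic \<xi>" "P \<noteq> 0" shows "poly (rp P) \<xi> \<noteq> 0"
proof
  assume "poly (rp P) \<xi> = 0"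
  moreover have "rp P \<noteq> 0" using assms by simp
  ultimately have "algebraic \<xi>"
    unfolding algebraic_def by (intro exI[of _ "rp P"]) (auto simp: coeff_map_poly)
  with assms show False by simp
qed

lemma abs_eval_eq_exp:
  assumes "\<not> algebraic \<xi>" "P \<noteq> 0" shows "\<bar>poly (rp P) \<xi>\<bar> = exp (- lv \<xi> P)"
  using transcendental_rp_nonzero[OF assms] by (simp add: lv_def)

lemma lv_mult:
  assumes "\<not> algebraic \<xi>" "A \<noteq> 0" "B \<noteq> 0"
  shows "lv \<xi> (A * B) = lv \<xi> A + lv \<xi> B"
  using transcendental_rp_nonzero[OF assms(1,2)] transcendental_rp_nonzero[OF assms(1,3)]
  by (simp add: lv_def of_int_poly_hom.hom_mult abs_mult ln_mult)

lemma lv_const_le: "degree P = 0 \<Longrightarrow> P \<noteq> 0 \<Longrightarrow> lv \<xi> P \<le> 0"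
proof -
  assume a: "degree P = 0" "P \<noteq> 0"
  then obtain c where c: "P = [:c:]" "c \<noteq> 0" by (metis degree_eq_zeroE pCons_0_0)
  then have "\<bar>real_of_int c\<bar> \<ge> 1" by linarith
  then show ?thesis by (simp add: lv_def c map_poly_pCons)
qed

text \<open>A transcendental number is nonzero, so each factor X changes the order of smallness by
  the fixed amount ln |\<xi>|. Up to a constant, shifted polynomials approximate as well as the
  original ones.\<close>

lemma lv_monom_mult:
  assumes "\<not> algebraic \<xi>" "P \<noteq> 0" "k \<le> N"
  shows "lv \<xi> P - real N * \<bar>ln \<bar>\<xi>\<bar>\<bar> \<le> lv \<xi> (monom 1 k * P)"
proof -
  have "\<xi> \<noteq> 0" using assms(1) by auto
  have "lv \<xi> (monom 1 k * P) = lv \<xi> (monom 1 k) + lv \<xi> P"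
    by (rule lv_mult) (use assms in \<open>auto simp: monom_eq_0_iff\<close>)
  moreover have "lv \<xi> (monom 1 k) = - (real k * ln \<bar>\<xi>\<bar>)"
    using \<open>\<xi> \<noteq> 0\<close> by (simp add: lv_def rp_monom poly_monom power_abs ln_realpow)
  moreover have "real k * ln \<bar>\<xi>\<bar> \<le> real k * \<bar>ln \<bar>\<xi>\<bar>\<bar>"
    by (intro mult_left_mono) auto
  moreover have "real k * \<bar>ln \<bar>\<xi>\<bar>\<bar> \<le> real N * \<bar>ln \<bar>\<xi>\<bar>\<bar>"
    by (intro mult_right_mono) (use assms in auto)
  ultimately show ?thesis by simp
qed

section \<open>Determinants and resultants\<close>

lemma poly_eq_sum_le:
  fixes p :: "real poly"
  assumes "degree p \<le> N"
  shows "poly p x = (\<Sum>i\<le>N. coeff p i * x ^ i)"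
  unfolding poly_altdef by (rule sum.mono_neutral_left) (use assms in \<open>auto simp: coeff_eq_0\<close>)

text \<open>The integer determinant of the coefficients is nonzero, hence at least 1 in absolute
  value. Row operations turn the row of constant terms into the values at \<xi>, and each term of
  the Leibniz expansion contains exactly one of these small values.\<close>

lemma det_inequality:
  assumes fin: "finite S" and card: "card S = Suc N"
    and S: "\<forall>P\<in>S. degree P \<le> N \<and> z \<le> lv \<xi> P"
    and ind: "pv.independent (rp ` S)" and alg: "\<not> algebraic \<xi>"
  shows "z \<le> (\<Sum>P\<in>S. lh P) + ln (fact (Suc N))"
proof -
  define n where "n = Suc N"
  obtain f where f: "bij_betw f {..<n} S"
    using ex_bij_betw_nat_finite[OF fin] card by (auto simp: n_def atLeast0LessThan)
  have fS: "f j \<in> S" if "j < n" for j using f that by (auto simp: bij_betw_def)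
  have inj: "inj rp" by (simp add: inj_on_def)
  have f0: "f j \<noteq> 0" if "j < n" for j
  proof
    assume "f j = 0"
    then have "0 \<in> rp ` S" using fS[OF that] by (metis image_eqI of_int_poly_hom.hom_zero)
    then show False using ind pv.dependent_zero by blast
  qed
  define A where "A = mat n n (\<lambda>(i, j). real_of_int (coeff (f j) i))"
  define Z where "Z = mat n n (\<lambda>(i, j). coeff (f j) i)"
  \<comment> \<open>The polynomials are the columns of \<open>A\<close>. The matrix \<open>L\<close>
    is unipotent, and row 0 of \<open>L * A\<close> lists the values of the polynomials at
    \<xi>.\<close>
  define L where "L = mat n n (\<lambda>(i, j). if i = 0 then \<xi> ^ j else if i = j then 1 else 0)"
  have A: "A \<in> carrier_mat n n" and L: "L \<in> carrier_mat n n" and Z: "Z \<in> carrier_mat n n"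
    by (auto simp: A_def L_def Z_def)
  have AZ: "A = map_mat real_of_int Z" by (auto simp: A_def Z_def)
  have detA: "Determinant.det A \<noteq> 0"
  proof
    assume "Determinant.det A = 0"
    then obtain v where v: "v \<in> carrier_vec n" "v \<noteq> 0\<^sub>v n" "A *\<^sub>v v = 0\<^sub>v n"
      using det_0_iff_vec_prod_zero[OF A] by auto
    have "(\<Sum>j<n. Polynomial.smult (vec_index v j) (rp (f j))) = 0"
    proof (rule poly_eqI)
      fix i
      show "coeff (\<Sum>j<n. Polynomial.smult (vec_index v j) (rp (f j))) i = coeff 0 i"
      proof (cases "i < n")
        case True
        have "vec_index (A *\<^sub>v v) i = 0" using v True by simp
        moreover have "vec_index (A *\<^sub>v v) i = (\<Sum>j<n. real_of_int (coeff (f j) i) * vec_index v j)"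
          using True v(1) by (simp add: A_def scalar_prod_def atLeast0LessThan)
        ultimately show ?thesis by (simp add: coeff_sum coeff_map_poly mult.commute)
      next
        case False
        then have "coeff (f j) i = 0" if "j < n" for j
          using S fS[OF that] by (intro coeff_eq_0) (auto simp: n_def)
        then show ?thesis by (simp add: coeff_sum coeff_map_poly)
      qed
    qed
    moreover have "(\<Sum>j<n. Polynomial.smult (vec_index v j) (rp (f j))) =
        (\<Sum>p\<in>rp ` S. Polynomial.smult (vec_index v (the_inv_into {..<n} f (the_inv rp p))) p)"
    proof -
      have "(\<Sum>j<n. Polynomial.smult (vec_index v j) (rp (f j))) =
        (\<Sum>j<n. Polynomial.smult (vec_index v (the_inv_into {..<n} f (f j))) (rp (f j)))"
        using f by (intro sum.cong) (auto simp: bij_betw_def the_inv_into_f_f)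
      also have "\<dots> = (\<Sum>P\<in>S. Polynomial.smult (vec_index v (the_inv_into {..<n} f P)) (rp P))"
        by (rule sum.reindex_bij_betw[OF f])
      also have "\<dots> = (\<Sum>p\<in>rp ` S. Polynomial.smult (vec_index v (the_inv_into {..<n} f (the_inv rp p))) p)"
        by (subst sum.reindex) (use inj in \<open>auto simp: inj_on_def the_inv_f_f\<close>)
      finally show ?thesis .
    qed
    ultimately have z: "vec_index v (the_inv_into {..<n} f (the_inv rp p)) = 0" if "p \<in> rp ` S" for p
      using pv.independentD[OF ind _ subset_refl _ that] fin by auto
    have "vec_index v j = 0" if "j < n" for j
      using z[of "rp (f j)"] fS[OF that] f that inj
      by (simp add: the_inv_f_f bij_betw_def the_inv_into_f_f)
    then have "v = 0\<^sub>v n" using v(1) by auto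
    with v(2) show False by simp
  qed
  have "Determinant.det L = prod_list (diag_mat L)"
    by (rule det_upper_triangular[OF _ L]) (auto simp: L_def)
  also have "\<dots> = (\<Prod>i<n. L $$ (i, i))"
    using L by (simp add: prod_list_diag_prod atLeast0LessThan)
  also have "\<dots> = 1" by (rule prod.neutral) (auto simp: L_def)
  finally have detL: "Determinant.det L = 1" .
  define B where "B = L * A"
  have B: "B \<in> carrier_mat n n" using L A by (simp add: B_def)
  have detB: "Determinant.det B = Determinant.det A"
    using det_mult[OF L A] detL by (simp add: B_def)
  have "Determinant.det A = real_of_int (Determinant.det Z)"
    unfolding AZ by (simp add: of_int_hom.hom_det)
  with detA have "1 \<le> \<bar>Determinant.det B\<bar>" unfolding detB by simp
  also have "Determinant.det B = (\<Sum>p | p permutes {0..<n}. signof p * (\<Prod>j<n. B $$ (p j, j)))"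
    using det_col[OF B] by (simp add: atLeast0LessThan)
  also have "\<bar>\<dots>\<bar> \<le> (\<Sum>p | p permutes {0..<n}. exp (- z) * (\<Prod>j<n. poly_height (rp (f j))))"
  proof (rule order_trans[OF sum_abs sum_mono])
    fix p assume "p \<in> {p. p permutes {0..<n}}"
    then have p: "p permutes {0..<n}" by simp
    have pj: "p j < n" if "j < n" for j using permutes_in_image[OF p, of j] that by simp
    have entry: "\<bar>B $$ (p j, j)\<bar> \<le> (if p j = 0 then exp (- z) else 1) * poly_height (rp (f j))"
      if j: "j < n" for j
    proof (cases "p j = 0")
      case True
      have "B $$ (0, j) = (\<Sum>i<n. \<xi> ^ i * real_of_int (coeff (f j) i))"
        using j by (simp add: B_def L_def A_def scalar_prod_def atLeast0LessThan)
      also have "\<dots> = poly (rp (f j)) \<xi>"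
      proof -
        have "poly (rp (f j)) \<xi> = (\<Sum>i\<le>N. coeff (rp (f j)) i * \<xi> ^ i)"
          by (rule poly_eq_sum_le) (use S fS[OF j] in auto)
        then show ?thesis by (simp add: n_def lessThan_Suc_atMost coeff_map_poly mult.commute)
      qed
      finally have "\<bar>B $$ (p j, j)\<bar> = exp (- lv \<xi> (f j))"
        using abs_eval_eq_exp[OF alg f0[OF j]] True by simp
      also have "\<dots> \<le> exp (- z) * 1" using S fS[OF j] by auto
      \<comment> \<open>The height, at least 1 for a nonzero integer polynomial, is inserted so that
        every permutation yields the same product of heights.\<close>
      also have "\<dots> \<le> exp (- z) * poly_height (rp (f j))"
        by (intro mult_left_mono height_rp_ge_1 f0 j) auto
      finally show ?thesis using True by simp
    next
      case False
      then have "B $$ (p j, j) = (\<Sum>i<n. (if p j = i then 1 else 0) * real_of_int (coeff (f j) i))"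
        using j pj[OF j] by (simp add: B_def L_def A_def scalar_prod_def atLeast0LessThan)
      also have "\<dots> = real_of_int (coeff (f j) (p j))"
        using pj[OF j] by (simp add: if_distrib[where f = "\<lambda>x. x * _"] sum.delta' cong: if_cong)
      also have "\<bar>\<dots>\<bar> \<le> poly_height (rp (f j))"
        using abs_coeff_le_height[of "rp (f j)" "p j"] by (simp add: coeff_map_poly)
      finally show ?thesis using False by simp
    qed
    have "\<bar>signof p * (\<Prod>j<n. B $$ (p j, j))\<bar> = (\<Prod>j<n. \<bar>B $$ (p j, j)\<bar>)"
      by (simp add: abs_mult abs_prod sign_def)
    also have "\<dots> \<le> (\<Prod>j<n. (if p j = 0 then exp (- z) else 1) * poly_height (rp (f j)))"
      by (intro prod_mono conjI entry) auto
    also have "\<dots> = (\<Prod>j<n. if p j = 0 then exp (- z) else 1) * (\<Prod>j<n. poly_height (rp (f j)))"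
      by (rule prod.distrib)
    also have "(\<Prod>j<n. if p j = 0 then exp (- z) else 1) = (\<Prod>j<n. if j = 0 then exp (- z) else 1)"
      using permutes_imp_bij[OF p]
      by (intro prod.reindex_bij_betw[where g = "\<lambda>j. if j = 0 then exp (- z) else 1"])
         (simp add: atLeast0LessThan)
    also have "\<dots> = exp (- z)" by (simp add: prod.delta n_def)
    finally show "\<bar>signof p * (\<Prod>j<n. B $$ (p j, j))\<bar> \<le> exp (- z) * (\<Prod>j<n. poly_height (rp (f j)))" .
  qed
  also have "\<dots> = fact n * (exp (- z) * (\<Prod>j<n. poly_height (rp (f j))))"
    by (simp add: card_permutations)
  also have "(\<Prod>j<n. poly_height (rp (f j))) = exp (\<Sum>j<n. lh (f j))"
    by (simp add: exp_sum height_eq_exp_lh f0)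
  also have "(\<Sum>j<n. lh (f j)) = (\<Sum>P\<in>S. lh P)"
    by (rule sum.reindex_bij_betw[OF f])
  finally have "0 \<le> ln (fact n * (exp (- z) * exp (\<Sum>P\<in>S. lh P)))"
    by (rule ln_ge_zero)
  also have "\<dots> = ln (fact n) + (- z + (\<Sum>P\<in>S. lh P))"
    by (simp add: ln_mult)
  finally show "z \<le> (\<Sum>P\<in>S. lh P) + ln (fact (Suc N))"
    by (simp add: n_def)
qed

section \<open>Interpolation and Gelfond's inequality for heights of products\<close>

lemma height_zero [simp]: "poly_height 0 = 0"
  by (simp add: height_eq_0_iff)

lemma height_sum: "poly_height (\<Sum>i\<in>I. f i) \<le> (\<Sum>i\<in>I. poly_height (f i))"
proof (induction I rule: infinite_finite_induct)
  case (insert x F)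
  then show ?case using height_add[of "f x" "sum f F"] by simp
qed auto

text \<open>Lagrange interpolation at \<open>n + 1\<close> of the points; \<open>c\<close> is the
  sum of the heights of the basis polynomials.\<close>

lemma height_le_values:
  assumes "finite T" "card T > n"
  shows "\<exists>c\<ge>0. \<forall>A M. degree A \<le> n \<longrightarrow> (\<forall>t\<in>T. \<bar>poly A t\<bar> \<le> M) \<longrightarrow> poly_height A \<le> c * M"
proof -
  obtain T' where T': "T' \<subseteq> T" "card T' = Suc n"
    using assms by (metis Suc_leI obtain_subset_with_card_n)
  have finT': "finite T'" using T' assms finite_subset by blast
  define l where "l t = Polynomial.smult (1 / (\<Prod>s\<in>T' - {t}. t - s)) (\<Prod>s\<in>T' - {t}. [:- s, 1:])" for t :: real
  have degl: "degree (l t) \<le> n" if "t \<in> T'" for t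
  proof -
    have "degree (\<Prod>s\<in>T' - {t}. [:- s, 1:]) \<le> (\<Sum>s\<in>T' - {t}. 1)"
      by (rule order_trans[OF degree_prod_sum_le]) (use finT' in auto)
    also have "\<dots> = n" using that T' finT' by simp
    finally show ?thesis unfolding l_def using degree_smult_le order_trans by blast
  qed
  have vall: "poly (l t) s = (if s = t then 1 else 0)" if "t \<in> T'" "s \<in> T'" for s t
  proof (cases "s = t")
    case True
    have "(\<Prod>s\<in>T' - {t}. t - s) \<noteq> 0" using finT' by (simp add: prod_zero_iff)
    then show ?thesis using True by (simp add: l_def poly_prod)
  next
    case False
    then have "(\<Prod>r\<in>T' - {t}. s - r) = 0" using that finT' by (auto simp: prod_zero_iff)
    then show ?thesis using False by (simp add: l_def poly_prod)
  qed
  define c where "c = (\<Sum>t\<in>T'. poly_height (l t))"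
  have "poly_height A \<le> c * M" if A: "degree A \<le> n" and M: "\<forall>t\<in>T. \<bar>poly A t\<bar> \<le> M" for A M
  proof -
    have "A = (\<Sum>t\<in>T'. Polynomial.smult (poly A t) (l t))" (is "_ = ?B")
    proof (rule poly_eqI_degree[of T'])
      show "poly A s = poly ?B s" if "s \<in> T'" for s
      proof -
        have "poly ?B s = (\<Sum>t\<in>T'. if s = t then poly A t else 0)"
          unfolding poly_sum using that by (intro sum.cong) (auto simp: vall)
        also have "\<dots> = poly A s" using that finT' by simp
        finally show ?thesis by simp
      qed
      show "degree A < card T'" using A T' by simp
      have "degree ?B \<le> n"
        by (rule degree_sum_le) (use finT' degl degree_smult_le order_trans in blast)+
      then show "degree ?B < card T'" using T' by simp
    qed
    then have "poly_height A \<le> (\<Sum>t\<in>T'. poly_height (Polynomial.smult (poly A t) (l t)))"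
      using height_sum by metis
    also have "\<dots> \<le> (\<Sum>t\<in>T'. M * poly_height (l t))"
      by (intro sum_mono) (use M T' in \<open>auto simp: height_smult intro!: mult_right_mono\<close>)
    finally show ?thesis by (simp add: c_def sum_distrib_left mult.commute)
  qed
  moreover have "c \<ge> 0" by (simp add: c_def sum_nonneg)
  ultimately show ?thesis by blast
qed

lemma abs_poly_le_height:
  assumes "degree P \<le> N" "\<bar>t\<bar> \<le> r" "1 \<le> r"
  shows "\<bar>poly P t\<bar> \<le> (real N + 1) * r ^ N * poly_height P"
proof -
  have "\<bar>poly P t\<bar> \<le> (\<Sum>i\<le>N. \<bar>coeff P i * t ^ i\<bar>)"
    unfolding poly_eq_sum_le[OF assms(1)] by (rule sum_abs)
  also have "\<dots> \<le> (\<Sum>i\<le>N. poly_height P * r ^ N)"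
  proof (rule sum_mono)
    fix i assume "i \<in> {..N}"
    then have "\<bar>t\<bar> ^ i \<le> r ^ N"
      using power_mono[OF assms(2), of i] power_increasing[of i N r] assms(3) by auto
    then show "\<bar>coeff P i * t ^ i\<bar> \<le> poly_height P * r ^ N"
      unfolding abs_mult power_abs by (intro mult_mono abs_coeff_le_height) auto
  qed
  finally show ?thesis by (simp add: algebra_simps)
qed

text \<open>Relative to its height, a polynomial of degree at most \<open>n\<close> is small at no
  more than \<open>n\<close> of the \<open>2 * n + 1\<close> points of \<open>U\<close>. Hence at
  some point of \<open>U\<close> both factors are comparable to their heights.\<close>

lemma gelfond_height:
  "\<exists>c>0. \<forall>A B. degree A \<le> n \<longrightarrow> degree B \<le> n \<longrightarrow> poly_height A * poly_height B \<le> c * poly_height (A * B)"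
proof -
  define U where "U = real ` {..2 * n}"
  have U: "finite U" "card U = 2 * n + 1"
    by (simp_all add: U_def card_image inj_on_def)
  define \<T> where "\<T> = {T. T \<subseteq> U \<and> card T = Suc n}"
  have fT: "finite \<T>" using U by (simp add: \<T>_def)
  have "\<forall>T\<in>\<T>. \<exists>c\<ge>0. \<forall>A M. degree A \<le> n \<longrightarrow> (\<forall>t\<in>T. \<bar>poly A t\<bar> \<le> M) \<longrightarrow> poly_height A \<le> c * M"
    using height_le_values U finite_subset unfolding \<T>_def by (metis (mono_tags, lifting) lessI mem_Collect_eq)
  then obtain k where k: "\<And>T. T \<in> \<T> \<Longrightarrow> k T \<ge> 0"
    "\<And>T A M. T \<in> \<T> \<Longrightarrow> degree A \<le> n \<Longrightarrow> (\<forall>t\<in>T. \<bar>poly A t\<bar> \<le> M) \<Longrightarrow> poly_height A \<le> k T * M"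
    by (metis (no_types, lifting))
  \<comment> \<open>\<open>K\<close> exceeds each interpolation constant by at least 1, which makes
    the contradiction below strict.\<close>
  define K where "K = 1 + (\<Sum>T\<in>\<T>. k T)"
  have K: "K \<ge> 1" by (simp add: K_def k sum_nonneg)
  have kK: "k T + 1 \<le> K" if "T \<in> \<T>" for T
    using member_le_sum[OF that, of k] k(1) fT by (simp add: K_def)
  define bad where "bad A = {t\<in>U. K * \<bar>poly A t\<bar> < poly_height A}" for A
  have bad: "card (bad A) \<le> n" if "degree A \<le> n" for A
  proof (rule ccontr)
    assume "\<not> card (bad A) \<le> n"
    then obtain T where T: "T \<subseteq> bad A" "card T = Suc n"
      by (metis Suc_leI not_le obtain_subset_with_card_n)
    then have TT: "T \<in> \<T>" by (auto simp: \<T>_def bad_def)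
    have "poly_height A \<le> k T * (poly_height A / K)"
      by (rule k(2)[OF TT that]) (use T K in \<open>auto simp: bad_def field_simps intro: less_imp_le\<close>)
    also have "\<dots> < K * (poly_height A / K)"
    proof (rule mult_strict_right_mono)
      have "T \<noteq> {}" using T by auto
      then obtain t where "t \<in> bad A" using T by auto
      then have "poly_height A > K * \<bar>poly A t\<bar>" by (simp add: bad_def)
      moreover have "K * \<bar>poly A t\<bar> \<ge> 0" using K by simp
      ultimately have "poly_height A > 0" by linarith
      then show "0 < poly_height A / K" using K by simp
    qed (use kK[OF TT] in simp)
    finally show False using K by simp
  qed
  define c where "c = K\<^sup>2 * ((2 * real n + 1) * (2 * real n + 1) ^ (2 * n))"
  have "poly_height A * poly_height B \<le> c * poly_height (A * B)"
    if A: "degree A \<le> n" and B: "degree B \<le> n" for A B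
  proof -
    have "card (bad A \<union> bad B) < card U"
      using card_Un_le[of "bad A" "bad B"] bad[OF A] bad[OF B] U by linarith
    moreover have "finite (bad A \<union> bad B)" using U by (simp add: bad_def)
    ultimately have "\<not> U \<subseteq> bad A \<union> bad B" using card_mono by (metis not_le)
    then obtain t where t: "t \<in> U" "t \<notin> bad A" "t \<notin> bad B" by blast
    then have a: "poly_height A \<le> K * \<bar>poly A t\<bar>" and b: "poly_height B \<le> K * \<bar>poly B t\<bar>"
      by (auto simp: bad_def)
    have "poly_height A * poly_height B \<le> (K * \<bar>poly A t\<bar>) * (K * \<bar>poly B t\<bar>)"
      by (rule mult_mono[OF a b]) (use K in auto)
    also have "\<dots> = K\<^sup>2 * \<bar>poly (A * B) t\<bar>" by (simp add: power2_eq_square abs_mult)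
    also have "\<dots> \<le> K\<^sup>2 * ((real (2 * n) + 1) * (2 * real n + 1) ^ (2 * n) * poly_height (A * B))"
    proof (intro mult_left_mono abs_poly_le_height)
      show "degree (A * B) \<le> 2 * n" using degree_mult_le[of A B] A B by linarith
      show "\<bar>t\<bar> \<le> 2 * real n + 1" using t by (auto simp: U_def)
    qed auto
    finally show ?thesis by (simp add: c_def)
  qed
  moreover have "c > 0" using K by (auto simp: c_def intro!: mult_pos_pos zero_less_power)
  ultimately show ?thesis by blast
qed

lemma gelfond:
  "\<exists>c\<ge>0. \<forall>A B. A \<noteq> 0 \<longrightarrow> B \<noteq> 0 \<longrightarrow> degree A \<le> n \<longrightarrow> degree B \<le> n \<longrightarrow> lh A + lh B \<le> lh (A * B) + c"
proof -
  obtain c where c: "c > 0" and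
    h: "\<And>A B. degree A \<le> n \<Longrightarrow> degree B \<le> n \<Longrightarrow> poly_height A * poly_height B \<le> c * poly_height (A * B)"
    using gelfond_height[of n] by blast
  have "lh A + lh B \<le> lh (A * B) + \<bar>ln c\<bar>"
    if "A \<noteq> 0" "B \<noteq> 0" "degree A \<le> n" "degree B \<le> n" for A B
  proof -
    have "exp (lh A + lh B) \<le> c * exp (lh (A * B))"
      using h[of "rp A" "rp B"] that
      by (simp add: exp_add height_eq_exp_lh[symmetric] of_int_poly_hom.hom_mult)
    also have "\<dots> = exp (ln c + lh (A * B))" using c by (simp add: exp_add)
    finally have "lh A + lh B \<le> ln c + lh (A * B)" by simp
    then show ?thesis by linarith
  qed
  then show ?thesis by (intro exI[of _ "\<bar>ln c\<bar>"]) auto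
qed

section \<open>Prime factors and Bezout identities for integer polynomials\<close>

lemma exists_nonconst_prime_divisor:
  fixes P :: "int poly"
  assumes "degree P > 0"
  obtains Q where "prime_elem Q" "degree Q > 0" "Q dvd P"
proof -
  have P: "P \<noteq> 0" using assms by auto
  have "degree (primitive_part P) > 0" using assms by simp
  then have "\<not> is_unit (primitive_part P)" using is_unit_iff_degree by (metis is_unit_polyE degree_pCons_0 less_irrefl)
  moreover have "primitive_part P \<noteq> 0" using P by simp
  ultimately obtain Q where Q: "Q dvd primitive_part P" "prime Q" using prime_divisor_exists by blast
  \<comment> \<open>A constant prime factor would divide the content, which is 1 for a primitive
    part.\<close>
  have "degree Q > 0"
  proof (rule ccontr)
    assume "\<not> degree Q > 0"
    then obtain c where c: "Q = [:c:]" by (metis degree_eq_zeroE gr0I)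
    then have "c dvd content (primitive_part P)" using Q by (simp add: const_poly_dvd_iff_dvd_content)
    then have "is_unit c" using P by simp
    then have "is_unit Q" unfolding c by (simp add: is_unit_const_poly_iff)
    then show False using Q by auto
  qed
  moreover have "Q dvd P" using Q(1) by (metis content_times_primitive_part dvd_smult)
  ultimately show ?thesis using Q that by auto
qed

text \<open>The ring Z[X] is not Euclidean, so a nonzero combination \<open>R\<close> of least
  degree divides \<open>P\<close> and \<open>Q\<close> only up to integer constants, by
  pseudo-division. Primality of \<open>Q\<close> then forces \<open>R\<close> to be
  constant.\<close>

lemma prime_bezout:
  fixes P Q :: "int poly"
  assumes Q: "prime_elem Q" "degree Q > 0" and P: "\<not> Q dvd P"
  obtains A B c where "A * P + B * Q = [:c:]" "c \<noteq> 0"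
proof -
  define I where "I = {R. R \<noteq> 0 \<and> (\<exists>A B. R = A * P + B * Q)}"
  have "\<exists>A B. Q = A * P + B * Q" by (rule exI[of _ 0], rule exI[of _ 1]) simp
  moreover have "Q \<noteq> 0" using Q by auto
  ultimately have "Q \<in> I" unfolding I_def mem_Collect_eq by (intro conjI)
  then obtain R where R: "R \<in> I" and min: "\<And>S. S \<in> I \<Longrightarrow> degree R \<le> degree S"
    using ex_has_least_nat[of "\<lambda>x. x \<in> I" Q degree] by blast
  obtain A B where AB: "R = A * P + B * Q" and R0: "R \<noteq> 0" using R unfolding I_def by blast
  have div: "\<exists>k q. k \<noteq> 0 \<and> [:k:] * F = R * q" if F: "F = A' * P + B' * Q" for F A' B'
  proof -
    obtain q r where qr: "pseudo_divmod F R = (q, r)" by (cases "pseudo_divmod F R")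
    define k where "k = coeff R (degree R) ^ (Suc (degree F) - degree R)"
    have eq: "Polynomial.smult k F = R * q + r" and r: "r = 0 \<or> degree r < degree R"
      using pseudo_divmod[OF R0 qr] by (auto simp: k_def)
    have "r = ([:k:] * A' - q * A) * P + ([:k:] * B' - q * B) * Q"
    proof -
      have "r = [:k:] * F - R * q" using eq by simp
      also have "\<dots> = [:k:] * (A' * P + B' * Q) - (A * P + B * Q) * q" by (simp only: F AB)
      also have "\<dots> = ([:k:] * A' - q * A) * P + ([:k:] * B' - q * B) * Q"
        by (simp only: ring_distribs left_diff_distrib right_diff_distrib mult_ac)
      finally show ?thesis .
    qed
    then have "r \<in> I" if "r \<noteq> 0" using that unfolding I_def by blast
    then have "r = 0" using r min[of r] by linarith
    then have "[:k:] * F = R * q" using eq by simp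
    moreover have "k \<noteq> 0" using R0 by (simp add: k_def)
    ultimately show ?thesis by blast
  qed
  have "Q = 0 * P + 1 * Q" "P = 1 * P + 0 * Q" by simp_all
  from div[OF this(1)] div[OF this(2)] obtain k q k' q' where
    k: "k \<noteq> 0" "[:k:] * Q = R * q" and k': "k' \<noteq> 0" "[:k':] * P = R * q'" by blast
  have "Q dvd R * q" unfolding k(2)[symmetric] by (rule dvd_triv_right)
  then consider "Q dvd R" | "Q dvd q" using Q prime_elem_dvd_mult_iff by blast
  then show ?thesis
  proof cases
    case 1
    then have "Q dvd [:k':] * P" unfolding k'(2) by (rule dvd_mult2)
    then have "Q dvd [:k':]" using Q P prime_elem_dvd_mult_iff by blast
    then have "degree Q \<le> degree [:k':]" by (rule dvd_imp_degree_le) (use k'(1) in simp)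
    then show ?thesis using Q(2) by simp
  next
    case 2
    then obtain s where "q = Q * s" by blast
    then have "Q * [:k:] = Q * (R * s)" using k(2) by (simp only: mult_ac)
    then have ks: "[:k:] = R * s" using mult_left_cancel[OF \<open>Q \<noteq> 0\<close>] by blast
    then have "s \<noteq> 0" using k by auto
    then have "degree [:k:] = degree R + degree s" unfolding ks by (rule degree_mult_eq[OF R0])
    then have "degree R = 0" by simp
    then obtain c where "R = [:c:]" by (metis degree_eq_zeroE)
    then show ?thesis using AB R0 that[of A B c] by auto
  qed
qed

section \<open>Independent multiples of coprime polynomials and the resultant inequality\<close>

lemma family_independent:
  assumes "finite I" and c: "\<And>c. (\<Sum>i\<in>I. Polynomial.smult (c i) (g i)) = 0 \<Longrightarrow> (\<forall>i\<in>I. c i = 0)"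
  shows "inj_on g I" "pv.independent (g ` I)"
proof -
  show inj: "inj_on g I"
  proof (rule inj_onI, rule ccontr)
    fix i j assume ij: "i \<in> I" "j \<in> I" "g i = g j" "i \<noteq> j"
    define d where "d k = (if k = i then 1 else if k = j then - 1 else 0 :: real)" for k
    have "(\<Sum>k\<in>I. Polynomial.smult (d k) (g k)) = (\<Sum>k\<in>{i, j}. Polynomial.smult (d k) (g k))"
      by (rule sum.mono_neutral_right) (use assms(1) ij in \<open>auto simp: d_def\<close>)
    also have "\<dots> = 0" using ij by (simp add: d_def)
    finally have "d i = 0" using c ij by blast
    then show False by (simp add: d_def)
  qed
  show "pv.independent (g ` I)"
  proof (rule pv.independent_if_scalars_zero)
    fix u p assume "(\<Sum>p\<in>g ` I. Polynomial.smult (u p) p) = 0" and p: "p \<in> g ` I"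
    then have "(\<Sum>i\<in>I. Polynomial.smult (u (g i)) (g i)) = 0" by (simp add: sum.reindex[OF inj])
    then show "u p = 0" using c[of "\<lambda>i. u (g i)"] p by auto
  qed (use assms(1) in auto)
qed

text \<open>This is the nonvanishing of a Sylvester determinant. In a relation A P + B Q = 0 the
  Bezout identity makes \<open>P\<close> divide B, and the bound on \<open>b\<close> leaves only B =
  0.\<close>

lemma coprime_multiples_independent:
  fixes P Q :: "real poly" and a b :: nat
  assumes UV: "U * P + V * Q = [:k:]" "k \<noteq> 0" and P: "P \<noteq> 0" "b \<le> degree P"
  defines "g \<equiv> \<lambda>i. if i < a then monom 1 i * P else monom 1 (i - a) * Q"
  shows "inj_on g {..<a + b}" "pv.independent (g ` {..<a + b})"
proof -
  have main: "\<forall>i\<in>{..<a + b}. c i = 0" if c: "(\<Sum>i\<in>{..<a + b}. Polynomial.smult (c i) (g i)) = 0" for c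
  proof -
    define A where "A = (\<Sum>i<a. monom (c i) i)"
    define B where "B = (\<Sum>j<b. monom (c (a + j)) j)"
    have "(\<Sum>i\<in>{..<a + b}. Polynomial.smult (c i) (g i)) =
       (\<Sum>i<a. Polynomial.smult (c i) (g i)) + (\<Sum>j<b. Polynomial.smult (c (a + j)) (g (a + j)))"
      by (induction b) (auto simp: add.assoc)
    also have "(\<Sum>i<a. Polynomial.smult (c i) (g i)) = A * P"
      unfolding A_def sum_distrib_right
      by (intro sum.cong) (auto simp: g_def smult_monom mult_smult_left[symmetric])
    also have "(\<Sum>j<b. Polynomial.smult (c (a + j)) (g (a + j))) = B * Q"
      unfolding B_def sum_distrib_right
      by (intro sum.cong) (auto simp: g_def smult_monom mult_smult_left[symmetric])
    finally have 0: "A * P + B * Q = 0" using c by simp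
    have "Polynomial.smult k B = B * [:k:]" by simp
    also have "\<dots> = B * U * P + V * (B * Q)" unfolding UV(1)[symmetric] by (simp add: algebra_simps)
    also have "B * Q = - (A * P)" using 0 by (simp add: add_eq_0_iff)
    finally have "Polynomial.smult k B = P * (B * U - V * A)" by (simp add: algebra_simps)
    then have "P dvd B" using UV(2) by (metis dvd_triv_left dvd_smult_iff)
    have "B = 0"
    proof (rule ccontr)
      assume B: "B \<noteq> 0"
      then have "b > 0" by (cases b) (auto simp: B_def)
      have "degree B < b" unfolding B_def
        by (rule degree_sum_less) (use \<open>b > 0\<close> in \<open>auto intro: le_less_trans[OF degree_monom_le]\<close>)
      moreover have "degree P \<le> degree B" using \<open>P dvd B\<close> B by (rule dvd_imp_degree_le)
      ultimately show False using P by simp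
    qed
    moreover from this 0 P have "A = 0" by simp
    ultimately have cA: "coeff A i = 0" and cB: "coeff B i = 0" for i by auto
    have "c i = 0" if "i < a" for i
      using cA[of i] that by (simp add: A_def coeff_sum)
    moreover have "c (a + j) = 0" if "j < b" for j
      using cB[of j] that by (simp add: B_def coeff_sum)
    ultimately show ?thesis
      by (metis add_diff_inverse_nat lessThan_iff nat_add_left_cancel_less)
  qed
  show "inj_on g {..<a + b}" "pv.independent (g ` {..<a + b})"
    using family_independent[of "{..<a + b}" g, OF finite_lessThan main] by auto
qed

lemma inj_rp: "inj rp" by (simp add: inj_on_def)

text \<open>Logarithmic form of |Res(P, Q)| \<ge> 1, obtained from \<open>det_inequality\<close> for
  the Sylvester family of \<open>degree Q\<close> shifts of \<open>P\<close> and
  \<open>degree P\<close> shifts of \<open>Q\<close>.\<close>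

lemma resultant_inequality:
  assumes alg: "\<not> algebraic \<xi>" and Q: "prime_elem Q" "degree Q > 0" "degree Q \<le> n"
    and P: "\<not> Q dvd P" "degree P \<le> n"
  shows "min (lv \<xi> P) (lv \<xi> Q) \<le> degree P * lh Q + degree Q * lh P
           + (2 * real n * \<bar>ln \<bar>\<xi>\<bar>\<bar> + ln (fact (2 * n + 1)))"
proof -
  have P0: "P \<noteq> 0" and Q0: "Q \<noteq> 0" using P Q by auto
  define a b where "a = degree Q" and "b = degree P"
  obtain A B c where ABc: "A * P + B * Q = [:c:]" "c \<noteq> 0" using prime_bezout[OF Q(1,2) P(1)] .
  have UV: "rp A * rp P + rp B * rp Q = [:real_of_int c:]"
    using arg_cong[OF ABc(1), of rp] ABc(2) by (simp add: of_int_poly_hom.hom_mult of_int_poly_hom.hom_add map_poly_pCons)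
  define f where "f i = (if i < a then monom 1 i * P else monom 1 (i - a) * Q)" for i
  have rpf: "(\<lambda>i. rp (f i)) = (\<lambda>i. if i < a then monom 1 i * rp P else monom 1 (i - a) * rp Q)"
    by (auto simp: f_def of_int_poly_hom.hom_mult rp_monom)
  have inj: "inj_on (\<lambda>i. rp (f i)) {..<a + b}" and ind: "pv.independent ((\<lambda>i. rp (f i)) ` {..<a + b})"
    unfolding rpf using coprime_multiples_independent[OF UV, of b a] ABc P0 by (auto simp: b_def)
  have injf: "inj_on f {..<a + b}" using inj by (auto simp: inj_on_def)
  \<comment> \<open>The subtracted term pays for the shifts, whose exponents are at most
    \<open>2 * n\<close>.\<close>
  define z where "z = min (lv \<xi> P) (lv \<xi> Q) - 2 * real n * \<bar>ln \<bar>\<xi>\<bar>\<bar>"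
  have "z \<le> (\<Sum>F\<in>f ` {..<a + b}. lh F) + ln (fact (Suc (a + b - 1)))"
  proof (rule det_inequality[where \<xi> = \<xi>])
    have "a > 0" using Q by (simp add: a_def)
    then show "card (f ` {..<a + b}) = Suc (a + b - 1)" by (simp add: card_image[OF injf])
    show "pv.independent (rp ` f ` {..<a + b})" using ind by (simp add: image_image)
    show "\<forall>F\<in>f ` {..<a + b}. degree F \<le> a + b - 1 \<and> z \<le> lv \<xi> F"
    proof clarify
      fix i assume i: "i < a + b"
      show "degree (f i) \<le> a + b - 1 \<and> z \<le> lv \<xi> (f i)"
      proof (cases "i < a")
        case True
        then have "lv \<xi> P - real (2 * n) * \<bar>ln \<bar>\<xi>\<bar>\<bar> \<le> lv \<xi> (monom 1 i * P)"
          by (intro lv_monom_mult alg P0) (use Q in \<open>auto simp: a_def\<close>)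
        moreover have "degree (monom 1 i * P) = i + b" using P0
          by (subst degree_mult_eq) (auto simp: degree_monom_eq b_def monom_eq_0_iff)
        ultimately show ?thesis using True by (auto simp: f_def z_def)
      next
        case False
        then have "lv \<xi> Q - real (2 * n) * \<bar>ln \<bar>\<xi>\<bar>\<bar> \<le> lv \<xi> (monom 1 (i - a) * Q)"
          by (intro lv_monom_mult alg Q0) (use P i in \<open>auto simp: b_def\<close>)
        moreover have "degree (monom 1 (i - a) * Q) = i - a + a" using Q0
          by (subst degree_mult_eq) (auto simp: degree_monom_eq a_def monom_eq_0_iff)
        ultimately show ?thesis using False i by (auto simp: f_def z_def)
      qed
    qed
  qed (use alg in auto)
  also have "(\<Sum>F\<in>f ` {..<a + b}. lh F) = (\<Sum>i<a + b. lh (f i))"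
    by (simp add: sum.reindex[OF injf])
  also have "\<dots> = (\<Sum>i<a. lh (f i)) + (\<Sum>j<b. lh (f (a + j)))"
    by (induction b) (auto simp: add.assoc)
  also have "\<dots> = a * lh P + b * lh Q"
    by (simp add: f_def lh_monom_mult)
  also have "ln (fact (Suc (a + b - 1))) \<le> ln (fact (2 * n + 1) :: real)"
  proof -
    have "Suc (a + b - 1) \<le> 2 * n + 1" using Q P by (simp add: a_def b_def)
    then have "fact (Suc (a + b - 1)) \<le> (fact (2 * n + 1) :: real)" by (rule fact_mono)
    then show ?thesis by (subst ln_le_cancel_iff) (simp_all del: fact_Suc)
  qed
  finally show ?thesis by (simp add: z_def a_def b_def)
qed

section \<open>Reduction to prime polynomials and coprime pairs of good approximations\<close>

lemma finite_bounded_height: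
  "finite {P. degree P \<le> n \<and> poly_height (rp P) \<le> b}" (is "finite ?S")
proof (rule inj_on_finite)
  let ?f = "\<lambda>P::int poly. restrict (coeff P) {..n}"
  show "inj_on ?f ?S"
  proof (rule inj_onI, rule poly_eqI)
    fix P Q i assume PQ: "P \<in> ?S" "Q \<in> ?S" "?f P = ?f Q"
    show "coeff P i = coeff Q i"
    proof (cases "i \<le> n")
      case True
      then show ?thesis using fun_cong[OF PQ(3), of i] by simp
    qed (use PQ in \<open>auto simp: coeff_eq_0\<close>)
  qed
  show "?f ` ?S \<subseteq> PiE {..n} (\<lambda>_. {- \<lceil>b\<rceil>..\<lceil>b\<rceil>})"
  proof clarify
    fix P assume P: "poly_height (rp P) \<le> b"
    have "- \<lceil>b\<rceil> \<le> coeff P i \<and> coeff P i \<le> \<lceil>b\<rceil>" for i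
    proof -
      have "\<bar>real_of_int (coeff P i)\<bar> \<le> b"
        using abs_coeff_le_height[of "rp P" i] P by (simp add: coeff_map_poly)
      then show ?thesis by linarith
    qed
    then show "?f P \<in> PiE {..n} (\<lambda>_. {- \<lceil>b\<rceil>..\<lceil>b\<rceil>})" by auto
  qed
qed (auto intro: finite_PiE)

text \<open>Orders of smallness add up exactly and logarithmic heights up to Gelfond's constant, so
  prime factors can be peeled off by induction on the degree. The primes of height below exp
  \<open>L0\<close> are finitely many and go into the constant.\<close>

lemma lv_bound_from_primes:
  assumes alg: "\<not> algebraic \<xi>" and \<tau>: "\<tau> \<ge> 0"
    and prime: "\<And>Q. prime_elem Q \<Longrightarrow> 0 < degree Q \<Longrightarrow> degree Q \<le> n \<Longrightarrow> L0 \<le> lh Q \<Longrightarrow> lv \<xi> Q \<le> \<tau> * lh Q"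
  shows "\<exists>c\<ge>0. \<forall>P. P \<noteq> 0 \<longrightarrow> degree P \<le> n \<longrightarrow> lv \<xi> P \<le> \<tau> * lh P + c"
proof -
  obtain c1 where c1: "c1 \<ge> 0"
    "\<And>A B. A \<noteq> 0 \<Longrightarrow> B \<noteq> 0 \<Longrightarrow> degree A \<le> n \<Longrightarrow> degree B \<le> n \<Longrightarrow> lh A + lh B \<le> lh (A * B) + c1"
    using gelfond[of n] by blast
  define S where "S = {P. degree P \<le> n \<and> poly_height (rp P) \<le> exp L0}"
  have fS: "finite S" unfolding S_def by (rule finite_bounded_height)
  define c2 where "c2 = (\<Sum>P\<in>S. \<bar>lv \<xi> P\<bar>)"
  have c2: "c2 \<ge> 0" by (simp add: c2_def sum_nonneg)
  have prime': "lv \<xi> Q \<le> \<tau> * lh Q + c2" if Q: "prime_elem Q" "0 < degree Q" "degree Q \<le> n" for Q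
  proof (cases "L0 \<le> lh Q")
    case True
    then show ?thesis using prime[OF Q] c2 by simp
  next
    case False
    have Q0: "Q \<noteq> 0" using Q by auto
    then have "Q \<in> S" using False Q by (simp add: S_def height_eq_exp_lh)
    then have "\<bar>lv \<xi> Q\<bar> \<le> c2" unfolding c2_def by (intro member_le_sum) (use fS in auto)
    moreover have "\<tau> * lh Q \<ge> 0" using \<tau> lh_nonneg[OF Q0] by simp
    ultimately show ?thesis by linarith
  qed
  \<comment> \<open>Loss per peeled prime factor: Gelfond's constant weighted by \<tau>, plus the
    contribution of the small primes.\<close>
  define k where "k = \<tau> * c1 + c2"
  have k: "k \<ge> 0" using \<tau> c1 c2 by (simp add: k_def)
  have main: "lv \<xi> P \<le> \<tau> * lh P + real (degree P) * k" if "P \<noteq> 0" "degree P \<le> n" for P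
    using that
  proof (induction "degree P" arbitrary: P rule: less_induct)
    case less
    show ?case
    proof (cases "degree P = 0")
      case True
      then have "lv \<xi> P \<le> 0" using less lv_const_le by blast
      moreover have "\<tau> * lh P \<ge> 0" using \<tau> lh_nonneg less by simp
      ultimately show ?thesis using True by simp
    next
      case False
      then obtain Q where Q: "prime_elem Q" "degree Q > 0" "Q dvd P"
        using exists_nonconst_prime_divisor by blast
      then obtain R where R: "P = Q * R" by blast
      have 0: "Q \<noteq> 0" "R \<noteq> 0" using less R by auto
      have deg: "degree P = degree Q + degree R" using R 0 degree_mult_eq by blast
      have "lv \<xi> P = lv \<xi> Q + lv \<xi> R" unfolding R by (rule lv_mult[OF alg 0])
      also have "\<dots> \<le> (\<tau> * lh Q + c2) + (\<tau> * lh R + real (degree R) * k)"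
        using prime'[of Q] less.hyps[of R] less.prems Q 0 deg by fastforce
      also have "\<dots> = \<tau> * (lh Q + lh R) + c2 + real (degree R) * k" by (simp add: algebra_simps)
      also have "\<dots> \<le> \<tau> * (lh P + c1) + c2 + real (degree R) * k"
        using c1(2)[of Q R] 0 deg less.prems R \<tau> by (auto intro!: mult_left_mono)
      also have "\<dots> = \<tau> * lh P + (1 + real (degree R)) * k" by (simp add: k_def algebra_simps)
      also have "\<dots> \<le> \<tau> * lh P + real (degree P) * k"
        using deg Q(2) k by (intro add_left_mono mult_right_mono) auto
      finally show ?thesis .
    qed
  qed
  have "lv \<xi> P \<le> \<tau> * lh P + real n * k" if "P \<noteq> 0" "degree P \<le> n" for P
    using main[OF that] mult_right_mono[of "real (degree P)" "real n" k] k that by simp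
  then show ?thesis using k by (intro exI[of _ "real n * k"]) auto
qed

text \<open>There are at most \<open>degree P\<close> nonconstant prime factors, and a nonzero
  constant contributes nothing positive.\<close>

lemma lv_le_degree_times:
  assumes alg: "\<not> algebraic \<xi>" and "l \<ge> 0" and "P \<noteq> 0"
    and prime: "\<And>Q. prime_elem Q \<Longrightarrow> 0 < degree Q \<Longrightarrow> Q dvd P \<Longrightarrow> lv \<xi> Q \<le> l"
  shows "lv \<xi> P \<le> l * degree P"
  using assms(3,4)
proof (induction "degree P" arbitrary: P rule: less_induct)
  case less
  show ?case
  proof (cases "degree P = 0")
    case True
    then show ?thesis using less lv_const_le by simp
  next
    case False
    then obtain Q where Q: "prime_elem Q" "degree Q > 0" "Q dvd P"
      using exists_nonconst_prime_divisor by blast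
    then obtain R where R: "P = Q * R" by blast
    have 0: "Q \<noteq> 0" "R \<noteq> 0" using less R by auto
    have deg: "degree P = degree Q + degree R" using R 0 degree_mult_eq by blast
    have "lv \<xi> R \<le> l * degree R"
      by (rule less.hyps) (use deg Q 0 R less.prems in auto)
    moreover have "lv \<xi> Q \<le> l" using less.prems Q by blast
    moreover have "l * degree R + l * 1 \<le> l * degree P"
      unfolding deg using Q(2) mult_left_mono[of 1 "real (degree Q)" l] \<open>l \<ge> 0\<close> by (simp add: algebra_simps)
    ultimately show ?thesis using lv_mult[OF alg 0] R by simp
  qed
qed

text \<open>For transcendental \<xi>, this is the condition on an exponent in
  \<open>omega_hat\<close>, written logarithmically with Y = ln H.\<close>

definition uniformly_approximable :: "nat \<Rightarrow> real \<Rightarrow> real \<Rightarrow> bool" where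
  "uniformly_approximable n \<xi> w \<longleftrightarrow>
     (\<exists>Y0. \<forall>Y\<ge>Y0. \<exists>R. R \<noteq> 0 \<and> degree R \<le> n \<and> lh R \<le> Y \<and> w * Y \<le> lv \<xi> R)"

text \<open>Otherwise \<open>lv_bound_from_primes\<close> bounds the order of every polynomial by
  \<open>w' * lh P + c\<close>, which the approximations of exponent \<open>w > w'\<close> violate
  for large Y.\<close>

lemma good_primes_unbounded:
  assumes alg: "\<not> algebraic \<xi>" and good: "uniformly_approximable n \<xi> w" and w': "0 \<le> w'" "w' < w"
  shows "\<exists>Q. prime_elem Q \<and> 0 < degree Q \<and> degree Q \<le> n \<and> L0 \<le> lh Q \<and> w' * lh Q \<le> lv \<xi> Q"
proof (rule ccontr)
  assume neg: "\<not> ?thesis"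
  have "\<exists>c\<ge>0. \<forall>P. P \<noteq> 0 \<longrightarrow> degree P \<le> n \<longrightarrow> lv \<xi> P \<le> w' * lh P + c"
    by (rule lv_bound_from_primes[OF alg w'(1), of n L0]) (use neg in force)
  then obtain c where c: "c \<ge> 0" "\<And>P. P \<noteq> 0 \<Longrightarrow> degree P \<le> n \<Longrightarrow> lv \<xi> P \<le> w' * lh P + c"
    by blast
  obtain Y0 where Y0: "\<And>Y. Y \<ge> Y0 \<Longrightarrow> \<exists>R. R \<noteq> 0 \<and> degree R \<le> n \<and> lh R \<le> Y \<and> w * Y \<le> lv \<xi> R"
    using good unfolding uniformly_approximable_def by blast
  define Y where "Y = max Y0 ((c + 1) / (w - w'))"
  obtain R where R: "R \<noteq> 0" "degree R \<le> n" "lh R \<le> Y" "w * Y \<le> lv \<xi> R" using Y0[of Y] by (auto simp: Y_def)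
  have "w * Y \<le> w' * lh R + c" using R c(2) by force
  also have "\<dots> \<le> w' * Y + c" using R w' by (simp add: mult_left_mono)
  finally have "(w - w') * Y \<le> c" by (simp add: algebra_simps)
  moreover have "(w - w') * ((c + 1) / (w - w')) \<le> (w - w') * Y"
    using w' by (intro mult_left_mono) (auto simp: Y_def)
  ultimately show False using w' by simp
qed

text \<open>\<open>P\<close> is a good approximation whose logarithmic height lies below that of
  \<open>Q\<close> by more than Gelfond's constant, so it cannot be a multiple of \<open>Q\<close>.
  The resulting loss \<open>w * (c + 1)\<close> is absorbed by passing from \<open>w\<close> to
  \<open>w'\<close>.\<close>

lemma base_pair:
  assumes alg: "\<not> algebraic \<xi>" and good: "uniformly_approximable n \<xi> w" and w': "0 \<le> w'" "w' < w"
  shows "\<exists>Q P. prime_elem Q \<and> 0 < degree Q \<and> degree Q \<le> n \<and> L0 \<le> lh Q \<and> w' * lh Q \<le> lv \<xi> Q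
     \<and> P \<noteq> 0 \<and> degree P \<le> n \<and> lh P \<le> lh Q \<and> w' * lh Q \<le> lv \<xi> P \<and> \<not> Q dvd P"
proof -
  obtain c where c: "c \<ge> 0"
    "\<And>A B. A \<noteq> 0 \<Longrightarrow> B \<noteq> 0 \<Longrightarrow> degree A \<le> n \<Longrightarrow> degree B \<le> n \<Longrightarrow> lh A + lh B \<le> lh (A * B) + c"
    using gelfond[of n] by blast
  obtain Y0 where Y0: "\<And>Y. Y \<ge> Y0 \<Longrightarrow> \<exists>R. R \<noteq> 0 \<and> degree R \<le> n \<and> lh R \<le> Y \<and> w * Y \<le> lv \<xi> R"
    using good unfolding uniformly_approximable_def by blast
  define L1 where "L1 = Max {L0, Y0 + c + 1, w * (c + 1) / (w - w')}"
  obtain Q where Q: "prime_elem Q" "0 < degree Q" "degree Q \<le> n" "L1 \<le> lh Q" "w' * lh Q \<le> lv \<xi> Q"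
    using good_primes_unbounded[OF alg good w'] by blast
  have L1: "L0 \<le> lh Q" "Y0 \<le> lh Q - c - 1" "w * (c + 1) / (w - w') \<le> lh Q"
    using Q(4) by (auto simp: L1_def)
  obtain P where P: "P \<noteq> 0" "degree P \<le> n" "lh P \<le> lh Q - c - 1" "w * (lh Q - c - 1) \<le> lv \<xi> P"
    using Y0[OF L1(2)] by blast
  have "\<not> Q dvd P"
  proof
    assume "Q dvd P"
    then obtain S where S: "P = Q * S" by blast
    have 0: "Q \<noteq> 0" "S \<noteq> 0" using P S by auto
    have "degree S \<le> n" using S P 0 degree_mult_eq[of Q S] by auto
    then have "lh Q + lh S \<le> lh P + c" using c(2) 0 Q S by blast
    then show False using P lh_nonneg[OF 0(2)] by simp
  qed
  moreover have "w' * lh Q \<le> w * (lh Q - c - 1)"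
    using L1(3) w' by (simp add: field_simps)
  ultimately show ?thesis using Q L1 P c(1) by (intro exI[of _ Q] exI[of _ P]) auto
qed

section \<open>The exponent of a prime polynomial\<close>

text \<open>Peeling off one factor \<open>F\<close> costs the Gelfond defect \<eta> once, so the
  whole power costs \<open>b * \<eta>\<close>. The functions \<open>h\<close> and \<open>v\<close>
  are abstract because heights and orders are used later in a normalized scale.\<close>

lemma prime_power_split:
  fixes h v :: "int poly \<Rightarrow> real"
  assumes f1: "\<And>A B. A \<noteq> 0 \<Longrightarrow> B \<noteq> 0 \<Longrightarrow> degree A \<le> n \<Longrightarrow> degree B \<le> n \<Longrightarrow> h A + h B \<le> h (A * B) + \<eta>"
    and vm: "\<And>A B. A \<noteq> 0 \<Longrightarrow> B \<noteq> 0 \<Longrightarrow> v (A * B) = v A + v B"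
    and F: "prime_elem F" "degree F > 0" and S: "S \<noteq> 0" "degree S \<le> n"
  shows "\<exists>b W. W \<noteq> 0 \<and> \<not> F dvd W \<and> S = F ^ b * W \<and> b * degree F + degree W = degree S
    \<and> b * h F + h W \<le> h S + b * \<eta> \<and> v S = b * v F + v W"
proof -
  have F0: "F \<noteq> 0" using F(2) by auto
  have "\<not> is_unit F" using F(1) by (rule prime_elem_not_unit)
  then obtain W where W: "S = F ^ multiplicity F S * W" "\<not> F dvd W"
    using multiplicity_decompose'[OF S(1)] by blast
  have W0: "W \<noteq> 0" using W S by auto
  have deg: "degree (F ^ b * W) = b * degree F + degree W" for b
    using F0 W0 by (simp add: degree_mult_eq degree_power_eq)
  have hh: "b * h F + h W \<le> h (F ^ b * W) + b * \<eta>" if "degree (F ^ b * W) \<le> n" for b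
    using that
  proof (induction b)
    case (Suc b)
    have *: "F ^ Suc b * W = F * (F ^ b * W)" by (simp add: mult.assoc)
    have "degree (F ^ b * W) \<le> n" "degree F \<le> n" using Suc.prems unfolding deg by auto
    then have "b * h F + h W \<le> h (F ^ b * W) + b * \<eta>" "h F + h (F ^ b * W) \<le> h (F ^ Suc b * W) + \<eta>"
      unfolding * using Suc.IH f1[of F "F ^ b * W"] F0 W0 by auto
    then show ?case by (simp add: algebra_simps)
  qed simp
  have vv: "v (F ^ b * W) = b * v F + v W" for b
  proof (induction b)
    case (Suc b)
    have *: "F ^ Suc b * W = F * (F ^ b * W)" by (simp add: mult.assoc)
    show ?case unfolding * using vm[of F "F ^ b * W"] F0 W0 Suc by (simp add: algebra_simps)
  qed simp
  define b where "b = multiplicity F S"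
  have Sb: "S = F ^ b * W" using W(1) by (simp only: b_def)
  have "b * degree F + degree W = degree S" using deg[of b] by (simp only: Sb)
  moreover have "b * h F + h W \<le> h S + b * \<eta>" using hh[of b] S(2) by (simp only: Sb)
  moreover have "v S = b * v F + v W" using vv[of b] by (simp only: Sb)
  ultimately show ?thesis using W0 W(2) Sb by blast
qed

text \<open>Here \<open>h P\<close> and \<open>v P\<close> stand for \<open>ln H(P) / ln X\<close> and \<open>- ln \<bar>P(\<xi>)\<bar> / ln X\<close> with \<open>X = H(Q)\<close>, and
  \<open>\<eta>\<close> absorbs the multiplicative constants.\<close>

lemma prime_exponent_core:
  fixes h v :: "int poly \<Rightarrow> real" and d s \<eta> :: real
  assumes n: "22 * d ^ 3 \<le> real n" and d: "d \<ge> 1000" and s: "s > 6 * d\<^sup>2"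
    and \<eta>: "0 < \<eta>" "8 * (real n)\<^sup>2 * \<eta> \<le> 1"
    and Q: "prime_elem Q" "0 < degree Q" "degree Q \<le> n" "h Q = 1" "v Q = 2 * real n + s"
    and h0: "\<And>P. P \<noteq> 0 \<Longrightarrow> h P \<ge> 0"
    and f1: "\<And>A B. A \<noteq> 0 \<Longrightarrow> B \<noteq> 0 \<Longrightarrow> degree A \<le> n \<Longrightarrow> degree B \<le> n \<Longrightarrow> h A + h B \<le> h (A * B) + \<eta>"
    and vm: "\<And>A B. A \<noteq> 0 \<Longrightarrow> B \<noteq> 0 \<Longrightarrow> v (A * B) = v A + v B"
    and f2: "\<And>A B. prime_elem A \<Longrightarrow> 0 < degree A \<Longrightarrow> degree A \<le> n \<Longrightarrow> \<not> A dvd B \<Longrightarrow> degree B \<le> n \<Longrightarrow>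
               min (v B) (v A) \<le> degree B * h A + degree A * h B + \<eta>"
    and f3: "\<And>y. y \<ge> 1/2 \<Longrightarrow> \<exists>R. R \<noteq> 0 \<and> degree R \<le> n \<and> h R \<le> y \<and> (2 * real n - d) * y \<le> v R"
    and f4: "\<And>P (l::real). l \<ge> 0 \<Longrightarrow> P \<noteq> 0 \<Longrightarrow> (\<And>F. prime_elem F \<Longrightarrow> 0 < degree F \<Longrightarrow> F dvd P \<Longrightarrow> v F \<le> l) \<Longrightarrow> v P \<le> l * degree P"
  shows False
proof -
  define N where "N = real n"
  \<comment> \<open>The largest degree that a cofactor of \<open>Q\<close> can have.\<close>
  define g where "g = n - degree Q"
  have Q0: "Q \<noteq> 0" using Q(2) by auto
  have d2: "d\<^sup>2 \<ge> 1000 * d" using mult_right_mono[OF d, of d] d by (simp add: power2_eq_square)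
  have d3: "d ^ 3 \<ge> 1000 * d\<^sup>2" using mult_right_mono[OF d, of "d\<^sup>2"] by (simp add: power3_eq_cube power2_eq_square)
  have N: "N \<ge> 22000000 * d" "N \<ge> 22000 * d\<^sup>2" using n d2 d3 by (auto simp: N_def)
  have N1: "N > 0" "N \<ge> 1" using N d by linarith+
  have s1: "s \<ge> 6000 * d" using s d2 by linarith
  have NN: "N * 1 \<le> N\<^sup>2" using mult_left_mono[of 1 N N] N1 by (simp add: power2_eq_square)
  have \<eta>1: "N\<^sup>2 * \<eta> \<le> 1/8" using \<eta>(2) by (simp add: N_def)
  have \<eta>b: "x * \<eta> \<le> 1/8" if "x \<le> N\<^sup>2" for x
    using mult_right_mono[OF that less_imp_le[OF \<eta>(1)]] \<eta>1 by linarith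
  have N\<eta>: "N * \<eta> \<le> 1/8" using \<eta>b[of N] NN by simp
  have \<eta>8: "\<eta> \<le> 1/8" using \<eta>b[of 1] NN N1 by simp
  have Nd\<eta>: "N * ((d + 3) * \<eta>) \<le> 1/8"
  proof -
    have "N * (d + 3) \<le> N * N" by (intro mult_left_mono) (use N d N1 in linarith)+
    then have "(N * (d + 3)) * \<eta> \<le> 1/8" by (intro \<eta>b) (simp add: power2_eq_square)
    then show ?thesis by (simp add: mult.assoc)
  qed
  have d\<eta>: "(d + 3) * \<eta> \<le> 1/8"
    by (rule \<eta>b) (use N NN N1 d in linarith)
  have gdeg: "real (degree Q) = N - real g" using Q(3) by (simp add: g_def N_def)
  \<comment> \<open>An approximation of height just below that of \<open>Q\<close> is no multiple of
    \<open>Q\<close>. The resultant inequality compares its order, about 2N - d, with the bound 2N -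
    g.\<close>
  have gd: "real g \<le> d + 1"
  proof -
    obtain R where R: "R \<noteq> 0" "degree R \<le> n" "h R \<le> 1 - 2 * \<eta>" "(2 * N - d) * (1 - 2 * \<eta>) \<le> v R"
      using f3[of "1 - 2 * \<eta>"] \<eta>8 by (auto simp: N_def)
    have "\<not> Q dvd R"
    proof
      assume "Q dvd R"
      then obtain S where S: "R = Q * S" by blast
      have S0: "S \<noteq> 0" using S R(1) by auto
      have "degree S \<le> n" using R(2) S Q0 S0 by (simp add: degree_mult_eq)
      then have "1 + h S \<le> h R + \<eta>" using f1[of Q S] Q0 S0 Q(3,4) S by simp
      moreover have "h S \<ge> 0" by (rule h0[OF S0])
      ultimately show False using R \<eta> by linarith
    qed
    then have "min (v R) (v Q) \<le> degree R * 1 + degree Q * h R + \<eta>"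
      using f2[OF Q(1,2,3) _ R(2)] Q(4) by simp
    also have "degree R * 1 \<le> N" using R by (simp add: N_def)
    also have "degree Q * h R \<le> real (degree Q) * 1"
      by (intro mult_left_mono) (use R \<eta> in linarith)+
    finally have m: "min (v R) (v Q) \<le> N + (N - real g) + \<eta>" by (simp add: gdeg)
    have "v Q > N + (N - real g) + \<eta>" using Q(5) s1 d \<eta>8 by (simp add: N_def)
    then have "v R \<le> N + (N - real g) + \<eta>" using m by linarith
    then have "(2 * N - d) * (1 - 2 * \<eta>) \<le> 2 * N - real g + \<eta>" using R by linarith
    moreover have "(2 * N - d) * (1 - 2 * \<eta>) = 2 * N - d - 4 * (N * \<eta>) + 2 * (d * \<eta>)" by (simp add: algebra_simps)
    moreover have "d * \<eta> \<ge> 0" using d \<eta> by simp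
    ultimately show ?thesis using N\<eta> \<eta>8 by linarith
  qed
  \<comment> \<open>\<open>r\<close> bounds the heights of the cofactors that occur, and \<kappa>
    bounds the error terms \<open>d * t / N\<close> for \<open>t <= s\<close>.\<close>
  define \<kappa> where "\<kappa> = d * s / N"
  define r where "r = s / N"
  have Nr: "N * r = s" using N1 by (simp add: r_def)
  have r0: "r \<ge> 0" using s1 d N1 by (simp add: r_def)
  have \<kappa>r: "\<kappa> = d * r" by (simp add: \<kappa>_def r_def)
  have \<kappa>0: "\<kappa> \<ge> 0" using r0 d by (simp add: \<kappa>r)
  have \<kappa>1: "22000 * (d * \<kappa>) \<le> s"
  proof -
    have "22000 * (d * d * r) \<le> N * r"
      using mult_right_mono[OF N(2) r0] by (simp add: power2_eq_square)
    then show ?thesis by (simp add: Nr \<kappa>r mult.assoc)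
  qed
  have \<kappa>2: "22000000 * \<kappa> \<le> s"
    using mult_right_mono[OF N(1) r0] by (simp add: Nr \<kappa>r mult.assoc)
  \<comment> \<open>\<open>err\<close> majorizes the right side of the resultant inequality for two
    polynomials of degree at most \<open>d + 1\<close> and height at most \<open>r\<close>.\<close>
  define err where "err = 2 * (d + 1) * r + 1"
  have r\<kappa>: "1000 * r \<le> \<kappa>" unfolding \<kappa>r by (rule mult_right_mono[OF d r0])
  have err: "err \<le> 3 * \<kappa> + 1" "err \<ge> 1"
    using r\<kappa> r0 \<kappa>0 by (auto simp: err_def \<kappa>r algebra_simps)
  \<comment> \<open>The good approximation at height 1 + t/N has order about 2N + 2t. If
    \<open>Q\<close> did not divide it, the resultant inequality would allow only about 2N + t,
    since \<open>Q\<close> itself has order 2N + s with \<open>t < s\<close>. Dividing by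
    \<open>Q\<close> leaves the cofactor.\<close>
  have St: "\<exists>S. S \<noteq> 0 \<and> degree S \<le> g \<and> h S \<le> t / N + \<eta> \<and> 2 * t - d - s - d * t / N \<le> v S"
    if t: "2 * d \<le> t" "t \<le> s - 1" for t
  proof -
    define u where "u = t / N"
    have u: "N * u = t" "u \<ge> 0" using N1 t d by (auto simp: u_def)
    have du: "20 * (d * u) \<le> t"
    proof -
      have "(20 * d) * u \<le> N * u" by (rule mult_right_mono) (use N d u in linarith)+
      then show ?thesis using u by simp
    qed
    obtain R where R: "R \<noteq> 0" "degree R \<le> n" "h R \<le> 1 + u" "(2 * N - d) * (1 + u) \<le> v R"
      using f3[of "1 + u"] u by (auto simp: N_def)
    have "Q dvd R"
    proof (rule ccontr)
      assume "\<not> Q dvd R"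
      then have "min (v R) (v Q) \<le> degree R * 1 + degree Q * h R + \<eta>"
        using f2[OF Q(1,2,3) _ R(2)] Q(4) by simp
      also have "degree R * 1 \<le> N" using R by (simp add: N_def)
      also have "degree Q * h R \<le> degree Q * (1 + u)"
        by (intro mult_left_mono) (use R in linarith)+
      finally have m: "min (v R) (v Q) \<le> N + (N - real g) * (1 + u) + \<eta>" by (simp add: gdeg)
      have gu: "real g * u \<ge> 0" using u by simp
      have e: "(N - real g) * (1 + u) = N - real g + t - real g * u" using u by (simp add: algebra_simps)
      have "v Q > N + (N - real g) * (1 + u) + \<eta>" unfolding e Q(5) using gu t \<eta>8 by (simp add: N_def)
      then have "(2 * N - d) * (1 + u) \<le> N + (N - real g + t - real g * u) + \<eta>" using m R e by linarith
      moreover have "(2 * N - d) * (1 + u) = 2 * N - d + 2 * t - d * u" using u by (simp add: algebra_simps)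
      ultimately show False using du t gu d \<eta>8 by linarith
    qed
    then obtain S where S: "R = Q * S" by blast
    have S0: "S \<noteq> 0" using S R(1) by auto
    have dS: "degree Q + degree S \<le> n" using R(2) S Q0 S0 by (simp add: degree_mult_eq)
    then have "1 + h S \<le> h R + \<eta>" using f1[of Q S] Q0 S0 Q(3,4) S by simp
    then have "h S \<le> t / N + \<eta>" using R by (simp add: u_def)
    moreover have "2 * t - d - s - d * t / N \<le> v S"
    proof -
      have "v R = v Q + v S" using vm[OF Q0 S0] S by simp
      moreover have "(2 * N - d) * (1 + u) = 2 * N - d + 2 * t - d * u" using u by (simp add: algebra_simps)
      ultimately show ?thesis using R Q(5) by (simp add: u_def N_def)
    qed
    ultimately show ?thesis using S0 dS by (intro exI[of _ S]) (auto simp: g_def)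
  qed
  obtain S where S: "S \<noteq> 0" "degree S \<le> g" "h S \<le> (s - 1) / N + \<eta>"
    "2 * (s - 1) - d - s - d * (s - 1) / N \<le> v S"
    using St[of "s - 1"] s1 d by auto
  \<comment> \<open>The lower bound of \<open>St\<close> at the top of the range,
    \<open>t = s - 1\<close>.\<close>
  define w where "w = s - d - 2 - \<kappa>"
  have vS: "w \<le> v S"
  proof -
    have "d * (s - 1) / N \<le> \<kappa>" unfolding \<kappa>_def using N1 d by (intro divide_right_mono) auto
    then show ?thesis using S by (simp add: w_def)
  qed
  have wbig: "w > (d + 2) * err"
  proof -
    have "(d + 2) * err \<le> (d + 2) * (3 * \<kappa> + 1)" by (intro mult_left_mono err) (use d in simp)
    also have "\<dots> = 3 * (d * \<kappa>) + 6 * \<kappa> + d + 2" by (simp add: algebra_simps)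
    also have "\<dots> < w" unfolding w_def using \<kappa>1 \<kappa>2 s1 d by linarith
    finally show ?thesis .
  qed
  have w0: "w > 0" using wbig mult_nonneg_nonneg[of "d + 2" err] err d by linarith
  \<comment> \<open>As S has degree at most \<open>d + 1\<close>, prime factors of order at most
    \<open>w / (d + 2)\<close> could not add up to \<open>w\<close>.\<close>
  obtain F where F: "prime_elem F" "0 < degree F" "F dvd S" "v F > w / (d + 2)"
  proof (rule ccontr)
    assume "\<not> thesis"
    then have "\<And>F. prime_elem F \<Longrightarrow> 0 < degree F \<Longrightarrow> F dvd S \<Longrightarrow> v F \<le> w / (d + 2)"
      using that not_less by blast
    then have "v S \<le> w / (d + 2) * degree S" using f4[of "w / (d + 2)" S] S(1) w0 d by simp
    also have "\<dots> \<le> w / (d + 2) * (d + 1)" using S(2) gd w0 d by (intro mult_left_mono) auto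
    also have "\<dots> < w" using w0 d by (simp add: field_simps)
    finally show False using vS by simp
  qed
  have vF: "v F > err"
  proof -
    have "err < w / (d + 2)" using wbig d by (simp add: pos_less_divide_eq mult.commute)
    then show ?thesis using F(4) by linarith
  qed
  have F0: "F \<noteq> 0" using F(2) by auto
  have gn: "g \<le> n" by (simp add: g_def)
  have Sn: "degree S \<le> n" using S gn by simp
  have "\<exists>b W. W \<noteq> 0 \<and> \<not> F dvd W \<and> S = F ^ b * W \<and> b * degree F + degree W = degree S
    \<and> b * h F + h W \<le> h S + b * \<eta> \<and> v S = b * v F + v W"
    by (rule prime_power_split[of n h \<eta> v F S]) (fact f1, fact vm, fact F(1), fact F(2), fact S(1), fact Sn)
  then obtain a U where U: "U \<noteq> 0" "\<not> F dvd U" "S = F ^ a * U" "a * degree F + degree U = degree S"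
    "a * h F + h U \<le> h S + a * \<eta>" "v S = a * v F + v U"
    by blast
  have a1: "a \<ge> 1"
  proof (rule ccontr)
    assume "\<not> a \<ge> 1"
    then have "a = 0" by simp
    then show False using U(2,3) F(3) by simp
  qed
  define e where "e = degree F"
  have e1: "e \<ge> 1" using F(2) by (simp add: e_def)
  have ae: "a * e \<le> g" using U(4) S(2) by (simp add: e_def)
  have ag: "a \<le> g" using ae e1 by (metis le_trans mult.commute mult_le_mono1 nat_mult_1)
  have aeR: "real a * real e \<le> d + 1" using ae gd by (metis of_nat_mult of_nat_mono order_trans)
  have aR: "real a \<le> d + 1" using ag gd by (meson of_nat_mono order_trans)
  have eR: "real e \<le> d + 1"
    using aeR a1 mult_right_mono[of 1 "real a" "real e"] by simp
  have Fn: "degree F \<le> n"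
  proof -
    have "e \<le> a * e" using a1 by simp
    then show ?thesis using ae gn unfolding e_def by linarith
  qed
  have hF: "h F \<ge> 0" and hU: "h U \<ge> 0" using h0[OF F0] h0[OF U(1)] by auto
  have ahF: "h F \<le> a * h F" using a1 hF mult_right_mono[of 1 "real a" "h F"] by simp
  have a\<eta>: "(real a + 1) * \<eta> \<le> (d + 2) * \<eta>" using aR \<eta> by (intro mult_right_mono) auto
  have sumh: "a * h F + h U \<le> (s - 1) / N + (d + 2) * \<eta>"
    using U(5) S(3) a\<eta> by (simp add: algebra_simps)
  have Nsumh: "N * (a * h F + h U) \<le> s"
  proof -
    have "N * (a * h F + h U) \<le> N * ((s - 1) / N + (d + 2) * \<eta>)"
      by (intro mult_left_mono sumh) (use N1 in simp)
    also have "\<dots> = s - 1 + N * ((d + 2) * \<eta>)" using N1 by (simp add: distrib_left)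
    also have "N * ((d + 2) * \<eta>) \<le> N * ((d + 3) * \<eta>)" using N1 \<eta> by (intro mult_left_mono mult_right_mono) auto
    finally show ?thesis using Nd\<eta> by linarith
  qed
  have sumr: "a * h F + h U \<le> r"
    using Nsumh N1 by (simp add: r_def field_simps)
  have hFr: "h F \<le> r" using sumr ahF hU by linarith
  \<comment> \<open>The resultant with \<open>F\<close>, whose order exceeds \<open>err\<close>: a
    cofactor prime to \<open>F\<close> has negligible order, so the order of a cofactor comes from
    its power of \<open>F\<close>.\<close>
  have small: "v W \<le> err" if W: "\<not> F dvd W" "W \<noteq> 0" "degree W \<le> g" "h W \<le> r" for W
  proof -
    have "min (v W) (v F) \<le> degree W * h F + degree F * h W + \<eta>"
      using f2[OF F(1,2) Fn W(1)] W(3) gn by simp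
    also have "degree W * h F \<le> (d + 1) * r"
      by (intro mult_mono hFr) (use W(3) gd hF d in auto)
    also have "degree F * h W \<le> (d + 1) * r"
      by (intro mult_mono W(4)) (use eR h0[OF W(2)] d in \<open>auto simp: e_def\<close>)
    finally have "min (v W) (v F) \<le> err" using \<eta>8 by (simp add: err_def algebra_simps)
    then show ?thesis using vF by linarith
  qed
  have vU: "v U \<le> err"
  proof (rule small[OF U(2,1)])
    show "degree U \<le> g" using U(4) S(2) by linarith
    show "h U \<le> r" using ahF hF sumr by linarith
  qed
  \<comment> \<open>The resultant with \<open>Q\<close>, which cannot divide \<open>F\<close> for
    reasons of degree and whose own order is too large to be the minimum.\<close>
  have vF2: "v F \<le> real e + N * h F + \<eta>"
  proof -
    have "degree F < degree Q"
    proof -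
      have "real e < N - real g" using eR gd N d by linarith
      then show ?thesis using gdeg by (simp add: e_def)
    qed
    then have "\<not> Q dvd F" using dvd_imp_degree_le[of Q F] F0 by linarith
    then have "min (v F) (v Q) \<le> degree F * 1 + degree Q * h F + \<eta>"
      using f2[OF Q(1,2,3) _ Fn] Q(4) by simp
    also have "degree Q * h F \<le> N * h F"
      by (intro mult_right_mono hF) (use gdeg in simp)
    finally have m: "min (v F) (v Q) \<le> real e + N * h F + \<eta>" by (simp add: e_def)
    have "N * h F \<le> s" using mult_left_mono[OF hFr, of N] N1 Nr by simp
    then have "v Q > real e + N * h F + \<eta>" using Q(5) eR \<eta>8 N d by (simp add: N_def)
    then show ?thesis using m by linarith
  qed
  \<comment> \<open>In the scale of the parameter \<open>t\<close>, \<open>s'\<close> is the height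
    of \<open>F\<close> and \<open>A\<close> that of \<open>F ^ a\<close>. The next estimates show
    that \<open>A\<close> is close to \<open>s\<close>.\<close>
  define s' where "s' = N * h F"
  have s'0: "s' \<ge> 0" using hF N1 by (simp add: s'_def)
  define A where "A = real a * s'"
  have a\<eta>1: "real a * \<eta> \<le> 1"
    using mult_right_mono[OF aR less_imp_le[OF \<eta>(1)]] d\<eta> \<eta> by (simp add: algebra_simps)
  have avF: "real a * v F \<le> d + 2 + A"
  proof -
    have "real a * v F \<le> real a * (real e + s' + \<eta>)"
      by (intro mult_left_mono) (use vF2 in \<open>auto simp: s'_def\<close>)
    then show ?thesis using aeR a\<eta>1 by (simp add: A_def algebra_simps)
  qed
  have avF2: "real a * v F \<ge> w - err" using U(6) vS vU by linarith
  have Alow: "A \<ge> w - err - d - 2" using avF avF2 by linarith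
  have As: "A \<le> s"
  proof -
    have "A = N * (a * h F)" by (simp add: A_def s'_def)
    also have "\<dots> \<le> N * (a * h F + h U)" using N1 hU by simp
    finally show ?thesis using Nsumh by linarith
  qed
  have t2: "2 * d \<le> A - 1" using Alow w_def err(1) \<kappa>2 s1 d by linarith
  \<comment> \<open>A cofactor just below the height of \<open>F ^ a\<close>. The gap 1 outweighs
    the accumulated Gelfond defects, so it contains fewer than \<open>a\<close> factors
    \<open>F\<close>.\<close>
  obtain S2 where S2: "S2 \<noteq> 0" "degree S2 \<le> g" "h S2 \<le> (A - 1) / N + \<eta>"
    "2 * (A - 1) - d - s - d * (A - 1) / N \<le> v S2"
    using St[OF t2] As by auto
  have S2n: "degree S2 \<le> n" using S2 gn by simp
  have "\<exists>b W. W \<noteq> 0 \<and> \<not> F dvd W \<and> S2 = F ^ b * W \<and> b * degree F + degree W = degree S2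
    \<and> b * h F + h W \<le> h S2 + b * \<eta> \<and> v S2 = b * v F + v W"
    by (rule prime_power_split[of n h \<eta> v F S2]) (fact f1, fact vm, fact F(1), fact F(2), fact S2(1), fact S2n)
  then obtain b W where W: "W \<noteq> 0" "\<not> F dvd W" "S2 = F ^ b * W" "b * degree F + degree W = degree S2"
    "b * h F + h W \<le> h S2 + b * \<eta>" "v S2 = b * v F + v W"
    by blast
  have "b * e \<le> g" using W(4) S2(2) by (simp add: e_def)
  then have "b \<le> g" using e1 by (metis le_trans mult.commute mult_le_mono1 nat_mult_1)
  then have bR: "real b \<le> d + 1" using gd by (meson of_nat_mono order_trans)
  have hW: "h W \<ge> 0" by (rule h0[OF W(1)])
  have "b * h F + h W \<le> (A - 1) / N + (real b + 1) * \<eta>" using W(5) S2(3) by (simp add: algebra_simps)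
  also have "(real b + 1) * \<eta> \<le> (d + 3) * \<eta>" using bR \<eta> by (intro mult_right_mono) auto
  finally have "N * (b * h F + h W) \<le> N * ((A - 1) / N + (d + 3) * \<eta>)"
    using N1 by (intro mult_left_mono) auto
  also have "\<dots> = A - 1 + N * ((d + 3) * \<eta>)" using N1 by (simp add: distrib_left)
  finally have Nb: "N * (b * h F + h W) < A" using Nd\<eta> by linarith
  have bs: "real b * s' < A"
  proof -
    have "N * (b * h F) \<le> N * (b * h F + h W)" using N1 hW by simp
    then show ?thesis using Nb by (simp add: s'_def algebra_simps)
  qed
  have "b < a"
  proof (rule ccontr)
    assume "\<not> b < a"
    then have "real a \<le> real b" by simp
    then have "A \<le> real b * s'" unfolding A_def using s'0 by (rule mult_right_mono)
    then show False using bs by simp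
  qed
  then have ba: "real b \<le> real a - 1" using nat_less_real_le[of b a] by linarith
  have "h W \<le> r"
  proof -
    have "N * h W \<le> N * (b * h F + h W)" using N1 hF by simp
    then have "N * h W \<le> s" using Nb As by linarith
    then show ?thesis using N1 by (simp add: r_def field_simps)
  qed
  moreover have "degree W \<le> g" using W(4) S2(2) by linarith
  ultimately have vW: "v W \<le> err" using small[OF W(2,1)] by blast
  have "v S2 \<le> (real a - 1) * v F + err"
    using mult_right_mono[OF ba, of "v F"] vF err W(6) vW by linarith
  also have "(real a - 1) * v F \<le> (real a - 1) * (real e + s' + \<eta>)"
    by (intro mult_left_mono) (use vF2 a1 in \<open>auto simp: s'_def\<close>)
  also have "\<dots> = real a * real e - real e + A - s' + real a * \<eta> - \<eta>" by (simp add: A_def algebra_simps)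
  finally have "v S2 \<le> d + 1 + A - s' + 1 + err" using aeR a\<eta>1 \<eta> by linarith
  moreover define z where "z = d * (A - 1) / N"
  moreover have "z \<le> \<kappa>"
    unfolding \<kappa>_def z_def using N1 d As by (intro divide_right_mono mult_left_mono) auto
  moreover have "2 * (A - 1) - d - s - z \<le> v S2" using S2(4) by (simp only: z_def)
  \<comment> \<open>With at most \<open>a - 1\<close> factors \<open>F\<close>, S2 has order at most
    about A - s', while \<open>St\<close> gives about 2A - s. Since \<open>A\<close> is nearly
    \<open>s\<close>, this bounds \<open>s'\<close>; then \<open>A = a * s'\<close> with
    \<open>a <= d + 1\<close> bounds \<open>s\<close> by about 4 d^2, against
    \<open>s > 6 * d^2\<close>.\<close>
  ultimately have "A + s' \<le> s + 2 * d + 4 + \<kappa> + err" by argo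
  then have "s' \<le> 4 * d + 8 + 2 * \<kappa> + 2 * err" using Alow by (simp add: w_def)
  then have s'le: "s' \<le> 4 * d + 10 + 8 * \<kappa>" using err by linarith
  have "A \<le> (d + 1) * s'" unfolding A_def using aR s'0 by (rule mult_right_mono)
  also have "\<dots> \<le> (d + 1) * (4 * d + 10 + 8 * \<kappa>)" by (intro mult_left_mono s'le) (use d in simp)
  also have "\<dots> = 4 * d\<^sup>2 + 14 * d + 10 + 8 * (d * \<kappa>) + 8 * \<kappa>" by (simp add: algebra_simps power2_eq_square)
  finally have "A \<le> 4 * d\<^sup>2 + 14 * d + 10 + 8 * (d * \<kappa>) + 8 * \<kappa>" .
  then have "s \<le> 4 * d\<^sup>2 + 17 * d + 17 + 8 * (d * \<kappa>) + 12 * \<kappa>"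
    using avF avF2 err d unfolding w_def by linarith
  then show False using \<kappa>1 \<kappa>2 s d2 d by linarith
qed

text \<open>All logarithms are divided by \<open>L = lh Q\<close>, so that \<open>Q\<close> gets
  height 1 as \<open>prime_exponent_core\<close> requires.\<close>

lemma prime_exponent_bound:
  assumes alg: "\<not> algebraic \<xi>" and good: "uniformly_approximable n \<xi> (2 * real n - d)"
    and n: "22 * d ^ 3 \<le> real n" and d: "d \<ge> 1000"
  shows "\<exists>L0. \<forall>Q. prime_elem Q \<longrightarrow> 0 < degree Q \<longrightarrow> degree Q \<le> n \<longrightarrow> L0 \<le> lh Q \<longrightarrow>
           lv \<xi> Q \<le> (2 * real n + 6 * d\<^sup>2) * lh Q"
proof -
  have d3: "d ^ 3 \<ge> 1" using d by (intro one_le_power) simp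
  have n1: "real n \<ge> 1" using n d3 by linarith
  obtain c1 where c1: "c1 \<ge> 0"
    "\<And>A B. A \<noteq> 0 \<Longrightarrow> B \<noteq> 0 \<Longrightarrow> degree A \<le> n \<Longrightarrow> degree B \<le> n \<Longrightarrow> lh A + lh B \<le> lh (A * B) + c1"
    using gelfond[of n] by blast
  define c2 where "c2 = 2 * real n * \<bar>ln \<bar>\<xi>\<bar>\<bar> + ln (fact (2 * n + 1))"
  obtain Y0 where Y0: "\<And>Y. Y \<ge> Y0 \<Longrightarrow> \<exists>R. R \<noteq> 0 \<and> degree R \<le> n \<and> lh R \<le> Y \<and> (2 * real n - d) * Y \<le> lv \<xi> R"
    using good unfolding uniformly_approximable_def by blast
  define \<eta> where "\<eta> = 1 / (8 * (real n)\<^sup>2)"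
  have \<eta>0: "\<eta> > 0" using n1 by (simp add: \<eta>_def)
  \<comment> \<open>After division by \<open>L\<close>, the Gelfond and resultant constants fall
    below \<eta>; the entry \<open>2 * Y0\<close> gives approximations for all normalized heights
    from 1/2 on.\<close>
  define L0 where "L0 = Max {1, c1 / \<eta>, c2 / \<eta>, 2 * Y0}"
  have "lv \<xi> Q \<le> (2 * real n + 6 * d\<^sup>2) * lh Q"
    if Q: "prime_elem Q" "0 < degree Q" "degree Q \<le> n" "L0 \<le> lh Q" for Q
  proof (rule ccontr)
    assume neg: "\<not> ?thesis"
    define L where "L = lh Q"
    have L: "L \<ge> 1" "c1 / \<eta> \<le> L" "c2 / \<eta> \<le> L" "2 * Y0 \<le> L" using Q(4) by (auto simp: L0_def L_def)
    have c1L: "c1 / L \<le> \<eta>" and c2L: "c2 / L \<le> \<eta>" using L \<eta>0 by (auto simp: field_simps)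
    have L0: "L > 0" using L by simp
    define h v where "h = (\<lambda>P. lh P / L)" and "v = (\<lambda>P. lv \<xi> P / L)"
    show False
    proof (rule prime_exponent_core[of d n "v Q - 2 * real n" \<eta> Q h v])
      show "22 * d ^ 3 \<le> real n" "1000 \<le> d" "0 < \<eta>" by fact+
      show "6 * d\<^sup>2 < v Q - 2 * real n" using neg L0 by (simp add: v_def L_def field_simps)
      show "8 * (real n)\<^sup>2 * \<eta> \<le> 1" using n1 by (simp add: \<eta>_def)
      show "prime_elem Q" "0 < degree Q" "degree Q \<le> n" by fact+
      show "h Q = 1" using L0 by (simp add: h_def L_def)
      show "v Q = 2 * real n + (v Q - 2 * real n)" by simp
      show "h P \<ge> 0" if "P \<noteq> 0" for P using lh_nonneg[OF that] L0 by (simp add: h_def)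
      show "h A + h B \<le> h (A * B) + \<eta>" if "A \<noteq> 0" "B \<noteq> 0" "degree A \<le> n" "degree B \<le> n" for A B
      proof -
        have "(lh A + lh B) / L \<le> (lh (A * B) + c1) / L"
          using c1(2)[OF that] L0 by (intro divide_right_mono) auto
        then show ?thesis using c1L by (simp add: h_def add_divide_distrib)
      qed
      show "v (A * B) = v A + v B" if "A \<noteq> 0" "B \<noteq> 0" for A B
        using lv_mult[OF alg that] by (simp add: v_def add_divide_distrib)
      show "min (v B) (v A) \<le> degree B * h A + degree A * h B + \<eta>"
        if A: "prime_elem A" "0 < degree A" "degree A \<le> n" "\<not> A dvd B" "degree B \<le> n" for A B
      proof -
        have "min (lv \<xi> B) (lv \<xi> A) / L \<le> (degree B * lh A + degree A * lh B + c2) / L"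
          using resultant_inequality[OF alg A] L0 unfolding c2_def by (intro divide_right_mono) auto
        moreover have "min (v B) (v A) = min (lv \<xi> B) (lv \<xi> A) / L"
          using L0 by (simp add: v_def min_def divide_le_cancel)
        ultimately show ?thesis using c2L by (simp add: h_def add_divide_distrib)
      qed
      show "\<exists>R. R \<noteq> 0 \<and> degree R \<le> n \<and> h R \<le> y \<and> (2 * real n - d) * y \<le> v R" if y: "y \<ge> 1/2" for y
      proof -
        have "1/2 * L \<le> y * L" using y L0 by (intro mult_right_mono) auto
        then have "Y0 \<le> y * L" using L(4) by linarith
        from Y0[OF this] obtain R where
          "R \<noteq> 0" "degree R \<le> n" "lh R \<le> y * L" "(2 * real n - d) * (y * L) \<le> lv \<xi> R" by blast
        then show ?thesis using L0
          by (intro exI[of _ R]) (auto simp: h_def v_def pos_divide_le_eq pos_le_divide_eq mult.assoc)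
      qed
      show "v P \<le> l * degree P"
        if P: "l \<ge> 0" "P \<noteq> 0" "\<And>F. prime_elem F \<Longrightarrow> 0 < degree F \<Longrightarrow> F dvd P \<Longrightarrow> v F \<le> l"
        for P and l :: real
      proof -
        have "lv \<xi> P \<le> (l * L) * degree P"
          by (rule lv_le_degree_times[OF alg _ P(2)])
             (use P(1,3) L0 in \<open>auto simp: v_def pos_divide_le_eq\<close>)
        then show ?thesis using L0 by (simp add: v_def pos_divide_le_eq mult_ac)
      qed
    qed
  qed
  then show ?thesis by blast
qed

lemma universal_lower_bound:
  assumes alg: "\<not> algebraic \<xi>" and good: "uniformly_approximable n \<xi> (2 * real n - d)"
    and n: "22 * d ^ 3 \<le> real n" and d: "d \<ge> 1000"
  shows "\<exists>c\<ge>0. \<forall>P. P \<noteq> 0 \<longrightarrow> degree P \<le> n \<longrightarrow> lv \<xi> P \<le> (2 * real n + 6 * d\<^sup>2) * lh P + c"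
proof -
  obtain L0 where "\<And>Q. prime_elem Q \<Longrightarrow> 0 < degree Q \<Longrightarrow> degree Q \<le> n \<Longrightarrow> L0 \<le> lh Q \<Longrightarrow>
      lv \<xi> Q \<le> (2 * real n + 6 * d\<^sup>2) * lh Q"
    using prime_exponent_bound[OF assms] by blast
  then show ?thesis by (intro lv_bound_from_primes[OF alg]) auto
qed

section \<open>Spaces of good approximations\<close>

text \<open>Gaussian elimination, each pivot being the largest coefficient of its polynomial. It
  lets the pigeonhole count use as many coefficients as there are generators instead of all
  \<open>n + 1\<close>.\<close>

lemma height_controlled_by_coordinates:
  fixes us :: "real poly list"
  assumes "\<forall>u\<in>set us. degree u \<le> n"
  shows "\<exists>I. I \<subseteq> {..n} \<and> card I \<le> length us \<and> (\<forall>P\<in>pv.span (set us). \<forall>M\<ge>0.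
           (\<forall>i\<in>I. \<bar>coeff P i\<bar> \<le> M) \<longrightarrow> poly_height P \<le> 3 ^ length us * M)"
  using assms
proof (induction "length us" arbitrary: us)
  case 0
  then show ?case by (intro exI[of _ "{}"]) auto
next
  case (Suc k)
  then obtain u us' where us: "us = u # us'" by (cases us) auto
  show ?case
  proof (cases "u = 0")
    case True
    have "\<exists>I. I \<subseteq> {..n} \<and> card I \<le> length us' \<and> (\<forall>P\<in>pv.span (set us'). \<forall>M\<ge>0.
           (\<forall>i\<in>I. \<bar>coeff P i\<bar> \<le> M) \<longrightarrow> poly_height P \<le> 3 ^ length us' * M)"
      using Suc us by auto
    then obtain I where I: "I \<subseteq> {..n}" "card I \<le> length us'"
      "\<And>P M. P \<in> pv.span (set us') \<Longrightarrow> M \<ge> 0 \<Longrightarrow> (\<forall>i\<in>I. \<bar>coeff P i\<bar> \<le> M) \<Longrightarrow> poly_height P \<le> 3 ^ length us' * M"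
      by blast
    have "poly_height P \<le> 3 ^ length us * M"
      if "P \<in> pv.span (set us)" "M \<ge> 0" "\<forall>i\<in>I. \<bar>coeff P i\<bar> \<le> M" for P M
    proof -
      have "P \<in> pv.span (set us')" using that(1) True us by (simp add: pv.span_insert_0)
      then have "poly_height P \<le> 3 ^ length us' * M" using I(3) that by blast
      also have "\<dots> \<le> 3 ^ length us * M" using that us by (intro mult_right_mono) auto
      finally show ?thesis .
    qed
    then show ?thesis using I us by (intro exI[of _ I]) auto
  next
    case False
    have "poly_height u \<in> (\<lambda>i. \<bar>coeff u i\<bar>) ` {..degree u}"
      unfolding poly_height_def by (rule Max_in) auto
    then obtain c where c: "c \<le> degree u" "poly_height u = \<bar>coeff u c\<bar>" by auto
    have uc: "\<bar>coeff u c\<bar> > 0" using c False height_eq_0_iff[of u] by auto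
    have cn: "c \<le> n" using c Suc.prems us by auto
    \<comment> \<open>\<open>T\<close> clears the pivot coefficient. The multiple of
      \<open>u\<close> removed has height \<open>\<bar>coeff P c\<bar>\<close>, hence at most
      \<open>M\<close>, so remaining coefficients at most double and one pivot costs a factor
      3.\<close>
    define T where "T P = P - Polynomial.smult (coeff P c / coeff u c) u" for P
    define us'' where "us'' = map T us'"
    have "\<forall>x\<in>set us''. degree x \<le> n"
    proof
      fix x assume "x \<in> set us''"
      then obtain y where y: "y \<in> set us'" "x = T y" by (auto simp: us''_def)
      then show "degree x \<le> n" using Suc.prems us unfolding T_def y(2)
        by (intro degree_diff_le) (auto intro: order_trans[OF degree_smult_le])
    qed
    then have "\<exists>I. I \<subseteq> {..n} \<and> card I \<le> length us'' \<and> (\<forall>P\<in>pv.span (set us''). \<forall>M\<ge>0.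
           (\<forall>i\<in>I. \<bar>coeff P i\<bar> \<le> M) \<longrightarrow> poly_height P \<le> 3 ^ length us'' * M)"
      using Suc us by (intro Suc.hyps(1)) (auto simp: us''_def)
    then obtain I where I: "I \<subseteq> {..n}" "card I \<le> length us''"
      "\<And>P M. P \<in> pv.span (set us'') \<Longrightarrow> M \<ge> 0 \<Longrightarrow> (\<forall>i\<in>I. \<bar>coeff P i\<bar> \<le> M) \<Longrightarrow> poly_height P \<le> 3 ^ length us'' * M"
      by blast
    have len: "length us = Suc (length us'')" using us by (simp add: us''_def)
    have "poly_height P \<le> 3 ^ length us * M"
      if P: "P \<in> pv.span (set us)" and M: "M \<ge> 0" "\<forall>i\<in>insert c I. \<bar>coeff P i\<bar> \<le> M" for P M
    proof -
      have "pv.subspace {P. T P \<in> pv.span (set us'')}"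
      proof (rule pv.subspaceI)
        show "0 \<in> {P. T P \<in> pv.span (set us'')}" by (simp add: T_def pv.span_zero)
        show "x + y \<in> {P. T P \<in> pv.span (set us'')}"
          if "x \<in> {P. T P \<in> pv.span (set us'')}" "y \<in> {P. T P \<in> pv.span (set us'')}" for x y
        proof -
          have "T (x + y) = T x + T y" by (simp add: T_def add_divide_distrib smult_add_left)
          then show ?thesis using that pv.span_add by auto
        qed
        show "Polynomial.smult a x \<in> {P. T P \<in> pv.span (set us'')}"
          if "x \<in> {P. T P \<in> pv.span (set us'')}" for a x
        proof -
          have "T (Polynomial.smult a x) = Polynomial.smult a (T x)"
            by (simp add: T_def smult_diff_right)
          then show ?thesis using that pv.span_scale by auto
        qed
      qed
      moreover have "set us \<subseteq> {P. T P \<in> pv.span (set us'')}"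
      proof -
        have "T u = 0" using uc by (simp add: T_def)
        then show ?thesis using us by (auto simp: us''_def pv.span_zero intro: pv.span_base)
      qed
      ultimately have "pv.span (set us) \<subseteq> {P. T P \<in> pv.span (set us'')}" by (intro pv.span_minimal)
      then have TP: "T P \<in> pv.span (set us'')" using P by blast
      define r where "r = coeff P c / coeff u c"
      have ru: "\<bar>r\<bar> * poly_height u = \<bar>coeff P c\<bar>" using uc by (simp add: r_def c(2) abs_divide)
      have "poly_height (T P) \<le> 3 ^ length us'' * (2 * M)"
      proof (rule I(3)[OF TP])
        show "\<forall>i\<in>I. \<bar>coeff (T P) i\<bar> \<le> 2 * M"
        proof
          fix i assume i: "i \<in> I"
          have "\<bar>r * coeff u i\<bar> \<le> \<bar>r\<bar> * poly_height u"
            unfolding abs_mult by (intro mult_left_mono abs_coeff_le_height) auto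
          also have "\<dots> \<le> M" using ru M by simp
          finally have "\<bar>r * coeff u i\<bar> \<le> M" .
          moreover have "\<bar>coeff P i\<bar> \<le> M" using M i by simp
          ultimately show "\<bar>coeff (T P) i\<bar> \<le> 2 * M" by (simp add: T_def r_def[symmetric])
        qed
      qed (use M in simp)
      moreover have "poly_height P \<le> poly_height (T P) + M"
      proof -
        have "P = T P + Polynomial.smult r u" by (simp add: T_def r_def)
        then have "poly_height P \<le> poly_height (T P) + poly_height (Polynomial.smult r u)"
          using height_add by metis
        also have "poly_height (Polynomial.smult r u) = \<bar>coeff P c\<bar>" by (simp add: height_smult ru)
        finally show ?thesis using M by simp
      qed
      moreover have "3 ^ length us'' * (2 * M) + M \<le> 3 ^ length us * M"
      proof -
        have "1 * M \<le> 3 ^ length us'' * M" by (intro mult_right_mono M) auto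
        then show ?thesis unfolding len power_Suc by linarith
      qed
      ultimately show ?thesis by linarith
    qed
    moreover have "card (insert c I) \<le> length us"
      using I(2) card_insert_le_m1[of "length us" I c] finite_subset[OF I(1)] len
      by (simp add: card_insert_if)
    ultimately show ?thesis using I(1) cn by (intro exI[of _ "insert c I"]) auto
  qed
qed

lemma rp_smult: "rp (Polynomial.smult r p) = Polynomial.smult (real_of_int r) (rp p)"
  by (rule poly_eqI) (simp add: coeff_map_poly)

text \<open>Boxes are counted in \<open>l\<close> coefficients and the value at \<xi>, and
  \<open>R\<close> serves to control the other coefficients. If \<open>R\<close> is already small
  enough at \<xi>, it is itself the required polynomial.\<close>

lemma short_polynomial_by_pigeonhole:
  assumes alg: "\<not> algebraic \<xi>" and B: "finite B" "card B = Suc l" "pv.independent (rp ` B)"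
    and Bn: "\<And>b. b \<in> B \<Longrightarrow> degree b \<le> n" and Ba: "\<And>b. b \<in> B \<Longrightarrow> lh b \<le> a"
    and By: "\<And>b. b \<in> B \<Longrightarrow> y \<le> lv \<xi> b"
    and R: "R \<noteq> 0" "rp R \<in> pv.span (rp ` B)" "degree R \<le> n" "lh R \<le> x" and xa: "x \<le> a"
  defines "c \<equiv> real (Suc l) * ln (5 * real (Suc l))"
  shows "\<exists>P. P \<noteq> 0 \<and> degree P \<le> n \<and> lh P \<le> x + c \<and> y - real l * (a - x) - c \<le> lv \<xi> P"
proof -
  define k where "k = Suc l"
  have k1: "real k \<ge> 1" by (simp add: k_def)
  have c: "exp c = (5 * real k) ^ k"
    unfolding c_def k_def exp_of_nat_mult by (subst exp_ln) auto
  define y' where "y' = y - real l * (a - x) - c"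
  show ?thesis
  proof (cases "y' \<le> lv \<xi> R")
    case True
    have "c \<ge> 0" by (simp add: c_def)
    then show ?thesis using R True by (intro exI[of _ R]) (auto simp: y'_def)
  next
    case False
    have B0: "b \<noteq> 0" if "b \<in> B" for b
    proof
      assume "b = 0"
      then have "0 \<in> rp ` B" using that by (metis image_eqI of_int_poly_hom.hom_zero)
      then show False using B(3) pv.dependent_zero by blast
    qed
    obtain b0 where b0: "b0 \<in> B" using B by fastforce
    define \<phi> where "\<phi> P = poly P \<xi>" for P :: "real poly"
    have \<phi>0: "\<phi> (rp b0) \<noteq> 0" using transcendental_rp_nonzero[OF alg B0[OF b0]] by (simp add: \<phi>_def)
    \<comment> \<open>Projection along \<open>b0\<close> onto the polynomials vanishing at \<xi>. It
      kills \<open>b0\<close>, so the image of the span has \<open>l\<close> generators.\<close>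
    define T where "T P = P - Polynomial.smult (\<phi> P / \<phi> (rp b0)) (rp b0)" for P
    obtain bs where bs: "set bs = B - {b0}" "length bs = l"
    proof -
      have "finite (B - {b0})" "card (B - {b0}) = l" using B b0 by auto
      then show ?thesis using that finite_distinct_list distinct_card by metis
    qed
    define us where "us = map (\<lambda>b. T (rp b)) bs"
    have "\<forall>u\<in>set us. degree u \<le> n"
    proof
      fix u assume "u \<in> set us"
      then obtain b where b: "b \<in> B" "u = T (rp b)" using bs(1) by (auto simp: us_def)
      have "degree (Polynomial.smult (\<phi> (rp b) / \<phi> (rp b0)) (rp b0)) \<le> n"
        by (rule order_trans[OF degree_smult_le]) (use Bn[OF b0] in simp)
      then show "degree u \<le> n" unfolding b(2) T_def
        by (intro degree_diff_le) (use Bn[OF b(1)] in simp)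
    qed
    from height_controlled_by_coordinates[OF this] obtain I where I: "I \<subseteq> {..n}" "card I \<le> l"
      "\<And>P M. P \<in> pv.span (set us) \<Longrightarrow> M \<ge> 0 \<Longrightarrow> (\<forall>i\<in>I. \<bar>coeff P i\<bar> \<le> M) \<Longrightarrow> poly_height P \<le> 3 ^ l * M"
      using bs(2) by (auto simp: us_def)
    have fI: "finite I" using I(1) finite_subset by blast
    have Tspan: "T P \<in> pv.span (set us)" if "P \<in> pv.span (rp ` B)" for P
    proof -
      have "pv.subspace {P. T P \<in> pv.span (set us)}"
      proof (rule pv.subspaceI)
        show "0 \<in> {P. T P \<in> pv.span (set us)}" by (simp add: T_def \<phi>_def pv.span_zero)
        show "p + q \<in> {P. T P \<in> pv.span (set us)}"
          if "p \<in> {P. T P \<in> pv.span (set us)}" "q \<in> {P. T P \<in> pv.span (set us)}" for p q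
        proof -
          have "T (p + q) = T p + T q" by (simp add: T_def \<phi>_def add_divide_distrib smult_add_left)
          then show ?thesis using that pv.span_add by auto
        qed
        show "Polynomial.smult r p \<in> {P. T P \<in> pv.span (set us)}"
          if "p \<in> {P. T P \<in> pv.span (set us)}" for r p
        proof -
          have "T (Polynomial.smult r p) = Polynomial.smult r (T p)"
            by (simp add: T_def \<phi>_def smult_diff_right)
          then show ?thesis using that pv.span_scale by auto
        qed
      qed
      moreover have "rp ` B \<subseteq> {P. T P \<in> pv.span (set us)}"
      proof clarify
        fix b assume b: "b \<in> B"
        show "T (rp b) \<in> pv.span (set us)"
        proof (cases "b = b0")
          case True
          then show ?thesis using \<phi>0 by (simp add: T_def pv.span_zero)
        next
          case False
          then show ?thesis using b bs(1) by (intro pv.span_base) (auto simp: us_def)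
        qed
      qed
      ultimately have "pv.span (rp ` B) \<subseteq> {P. T P \<in> pv.span (set us)}" by (intro pv.span_minimal)
      then show ?thesis using that by blast
    qed
    define X Y Y' where "X = exp x" and "Y = exp (- y)" and "Y' = exp (- y')"
    have pos: "X > 0" "Y > 0" "Y' > 0" by (auto simp: X_def Y_def Y'_def)
    have YY: "Y' / Y = (5 * real k) ^ k * exp (a - x) ^ l"
      unfolding c[symmetric] by (simp add: Y'_def Y_def y'_def exp_diff[symmetric] exp_add[symmetric] exp_of_nat_mult[symmetric])
    \<comment> \<open>The size of \<open>t0\<close> makes both box ratios \<open>m1\<close> and
      \<open>m2\<close> at least 1. By the choice of \<open>y'\<close>, the number of boxes is then
      at most \<open>t0 ^ k\<close>, less than the number \<open>Suc t0 ^ k\<close> of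
      combinations.\<close>
    obtain t0 :: nat where t0: "real t0 \<ge> max 1 (Y' / Y)" using real_arch_simple by blast
    define D where "D = PiE B (\<lambda>_. {..t0})"
    have cardD: "card D = Suc t0 ^ k" using B by (simp add: D_def card_PiE k_def)
    define Pt where "Pt t = (\<Sum>b\<in>B. Polynomial.smult (int (t b)) b)" for t
    have rpPt: "rp (Pt t) = (\<Sum>b\<in>B. Polynomial.smult (real (t b)) (rp b))" for t
      by (simp add: Pt_def of_int_poly_hom.hom_sum rp_smult)
    define m1 m2 where "m1 = k * t0 * exp (a - x)" and "m2 = k * t0 * (Y / Y')"
    have coeffb: "\<bar>coeff (rp (Pt t)) i / X\<bar> \<le> m1" if t: "t \<in> D" for t i
    proof -
      have "\<bar>coeff (rp (Pt t)) i\<bar> \<le> (\<Sum>b\<in>B. \<bar>real (t b) * coeff (rp b) i\<bar>)"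
        unfolding rpPt coeff_sum by (rule order_trans[OF sum_abs]) simp
      also have "\<dots> \<le> (\<Sum>b\<in>B. real t0 * exp a)"
      proof (rule sum_mono)
        fix b assume b: "b \<in> B"
        have "\<bar>coeff (rp b) i\<bar> \<le> exp a"
          using abs_coeff_le_height[of "rp b" i] height_eq_exp_lh[OF B0[OF b]] Ba[OF b] by (smt (verit) exp_le_cancel_iff)
        moreover have "t b \<le> t0" using t b by (auto simp: D_def PiE_def)
        ultimately show "\<bar>real (t b) * coeff (rp b) i\<bar> \<le> real t0 * exp a"
          unfolding abs_mult by (intro mult_mono) auto
      qed
      also have "\<dots> = k * t0 * exp a" by (simp only: sum_constant B(2) k_def mult.assoc of_nat_mult)
      finally have "\<bar>coeff (rp (Pt t)) i\<bar> / X \<le> k * t0 * exp a / X" using pos by (intro divide_right_mono) auto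
      then show ?thesis using pos by (simp add: m1_def X_def exp_diff abs_divide)
    qed
    have \<phi>b: "\<bar>\<phi> (rp (Pt t)) / Y'\<bar> \<le> m2" if t: "t \<in> D" for t
    proof -
      have "\<bar>\<phi> (rp (Pt t))\<bar> \<le> (\<Sum>b\<in>B. \<bar>real (t b) * \<phi> (rp b)\<bar>)"
        unfolding rpPt \<phi>_def poly_sum by (rule order_trans[OF sum_abs]) simp
      also have "\<dots> \<le> (\<Sum>b\<in>B. real t0 * Y)"
      proof (rule sum_mono)
        fix b assume b: "b \<in> B"
        have "\<bar>\<phi> (rp b)\<bar> \<le> Y"
          using abs_eval_eq_exp[OF alg B0[OF b]] By[OF b] by (simp add: \<phi>_def Y_def)
        moreover have "t b \<le> t0" using t b by (auto simp: D_def PiE_def)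
        ultimately show "\<bar>real (t b) * \<phi> (rp b)\<bar> \<le> real t0 * Y"
          unfolding abs_mult by (intro mult_mono) auto
      qed
      also have "\<dots> = k * t0 * Y" by (simp only: sum_constant B(2) k_def mult.assoc of_nat_mult)
      finally have "\<bar>\<phi> (rp (Pt t))\<bar> / Y' \<le> k * t0 * Y / Y'" using pos by (intro divide_right_mono) auto
      then show ?thesis using pos by (simp add: m2_def abs_divide)
    qed
    have kt: "real k * real t0 \<ge> 1 * 1" by (intro mult_mono) (use k1 t0 in auto)
    have m1: "m1 \<ge> 1"
    proof -
      have "1 * 1 \<le> (real k * real t0) * exp (a - x)" by (intro mult_mono) (use kt xa in auto)
      then show ?thesis by (simp add: m1_def)
    qed
    have m2: "m2 \<ge> 1"
    proof -
      have "Y' / Y * (Y / Y') \<le> real t0 * (Y / Y')" using t0 pos by (intro mult_right_mono) auto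
      then have "1 * 1 \<le> real k * (real t0 * (Y / Y'))" using pos k1 by (intro mult_mono) auto
      then show ?thesis by (simp add: m2_def)
    qed
    define E where "E = PiE I (\<lambda>_. {- \<lceil>m1\<rceil>..\<lceil>m1\<rceil>}) \<times> {- \<lceil>m2\<rceil>..\<lceil>m2\<rceil>}"
    \<comment> \<open>The box of a combination: coefficients in \<open>I\<close> in units of
      \<open>X\<close>, the value at \<xi> in units of \<open>Y'\<close>.\<close>
    define \<Phi> where "\<Phi> t = (restrict (\<lambda>i. \<lfloor>coeff (rp (Pt t)) i / X\<rfloor>) I, \<lfloor>\<phi> (rp (Pt t)) / Y'\<rfloor>)" for t
    have fl: "\<lfloor>z\<rfloor> \<in> {- \<lceil>m\<rceil>..\<lceil>m\<rceil>}" if "\<bar>z\<bar> \<le> m" for z m :: real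
      using that by (auto simp: abs_le_iff) linarith+
    have \<Phi>E: "\<Phi> ` D \<subseteq> E"
      using coeffb \<phi>b fl unfolding E_def \<Phi>_def by (auto simp del: atLeastAtMost_iff)
    have fE: "finite E" unfolding E_def by (intro finite_cartesian_product finite_PiE fI) auto
    have cc: "real (card {- \<lceil>m\<rceil>..\<lceil>m\<rceil>}) \<le> 5 * m" if "m \<ge> 1" for m :: real
    proof -
      have "real (card {- \<lceil>m\<rceil>..\<lceil>m\<rceil>}) = 2 * \<lceil>m\<rceil> + 1" using that by simp
      also have "\<dots> \<le> 5 * m" using that by linarith
      finally show ?thesis .
    qed
    have "real (card E) \<le> (5 * m1) ^ card I * (5 * m2)"
    proof -
      have "real (card E) = real (card {- \<lceil>m1\<rceil>..\<lceil>m1\<rceil>}) ^ card I * real (card {- \<lceil>m2\<rceil>..\<lceil>m2\<rceil>})"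
        unfolding E_def using fI by (simp only: card_cartesian_product card_PiE prod_constant of_nat_mult of_nat_power)
      also have "\<dots> \<le> (5 * m1) ^ card I * (5 * m2)"
        by (intro mult_mono power_mono cc m1 m2) (use m1 m2 in auto)
      finally show ?thesis .
    qed
    also have "\<dots> \<le> (5 * m1) ^ l * (5 * m2)"
      using m1 m2 I(2) by (intro mult_right_mono power_increasing) auto
    also have "\<dots> = (5 * real k) ^ k * real t0 ^ k * exp (a - x) ^ l * (Y / Y')"
    proof -
      have gen: "(A * T * E) ^ l * (A * T * Z) = A ^ Suc l * T ^ Suc l * E ^ l * Z" for A T E Z :: real
        by (simp add: power_mult_distrib)
      have "5 * m1 = 5 * real k * real t0 * exp (a - x)" "5 * m2 = 5 * real k * real t0 * (Y / Y')"
        by (simp_all add: m1_def m2_def)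
      then show ?thesis using gen[of "5 * real k" "real t0" "exp (a - x)" "Y / Y'"] by (simp only: k_def)
    qed
    also have "Y / Y' = 1 / ((5 * real k) ^ k * exp (a - x) ^ l)"
      unfolding YY[symmetric] by simp
    also have "(5 * real k) ^ k * real t0 ^ k * exp (a - x) ^ l * \<dots> = real t0 ^ k"
      using k1 by simp
    also have "\<dots> < real (Suc t0) ^ k" using k1 by (intro power_strict_mono) (auto simp: k_def)
    also have "\<dots> = real (card D)" by (simp add: cardD)
    finally have "card E < card D" by simp
    then have "\<not> inj_on \<Phi> D" using card_inj_on_le[OF _ \<Phi>E fE] by auto
    then obtain t t' where tt: "t \<in> D" "t' \<in> D" "t \<noteq> t'" "\<Phi> t = \<Phi> t'" by (auto simp: inj_on_def)
    define P where "P = Pt t - Pt t'"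
    have rpP: "rp P = rp (Pt t) - rp (Pt t')" by (simp add: P_def of_int_poly_hom.hom_minus)
    have rpP': "rp P = (\<Sum>b\<in>B. Polynomial.smult (real (t b) - real (t' b)) (rp b))"
      unfolding rpP rpPt by (simp add: sum_subtractf[symmetric] smult_diff_left)
    have P0: "P \<noteq> 0"
    proof
      assume "P = 0"
      then have 0: "(\<Sum>b\<in>B. Polynomial.smult (real (t b) - real (t' b)) (rp b)) = 0" using rpP' by simp
      define u where "u p = real (t (the_inv rp p)) - real (t' (the_inv rp p))" for p
      have "(\<Sum>p\<in>rp ` B. Polynomial.smult (u p) p) = (\<Sum>b\<in>B. Polynomial.smult (u (rp b)) (rp b))"
        by (subst sum.reindex) (auto simp: inj_on_def)
      also have "\<dots> = 0" unfolding 0[symmetric] by (simp add: u_def the_inv_f_f[OF inj_rp])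
      finally have eq: "(\<Sum>p\<in>rp ` B. Polynomial.smult (u p) p) = 0" .
      have "t b = t' b" if "b \<in> B" for b
      proof -
        have "u (rp b) = 0"
          by (rule pv.independentD[OF B(3) finite_imageI[OF B(1)] subset_refl eq]) (use that in simp)
        then show ?thesis by (simp add: u_def the_inv_f_f[OF inj_rp])
      qed
      then have "t = t'" using tt(1,2) unfolding D_def by (intro PiE_ext)
      then show False using tt by simp
    qed
    have close: "\<bar>p - q\<bar> \<le> z" if "\<lfloor>p / z\<rfloor> = \<lfloor>q / z\<rfloor>" "z > 0" for p q z :: real
    proof -
      have "\<bar>p / z - q / z\<bar> \<le> 1" using that(1) by linarith
      then have "\<bar>p - q\<bar> / z \<le> 1" using that(2) by (simp add: diff_divide_distrib[symmetric] abs_divide)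
      then show ?thesis using that(2) by (simp add: pos_divide_le_eq)
    qed
    have coeffP: "\<bar>coeff (rp P) i\<bar> \<le> X" if "i \<in> I" for i
    proof -
      have "\<lfloor>coeff (rp (Pt t)) i / X\<rfloor> = \<lfloor>coeff (rp (Pt t')) i / X\<rfloor>"
        using tt(4) that by (auto simp: \<Phi>_def dest!: fun_cong[of _ _ i])
      then show ?thesis using close pos unfolding rpP coeff_diff by blast
    qed
    have \<phi>P: "\<bar>\<phi> (rp P)\<bar> \<le> Y'"
    proof -
      have "\<lfloor>\<phi> (rp (Pt t)) / Y'\<rfloor> = \<lfloor>\<phi> (rp (Pt t')) / Y'\<rfloor>" using tt(4) by (simp add: \<Phi>_def)
      then have "\<bar>\<phi> (rp (Pt t)) - \<phi> (rp (Pt t'))\<bar> \<le> Y'" using close pos by blast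
      then show ?thesis unfolding rpP by (simp add: \<phi>_def)
    qed
    have \<phi>R: "\<bar>\<phi> (rp R)\<bar> = exp (- lv \<xi> R)" using abs_eval_eq_exp[OF alg R(1)] by (simp add: \<phi>_def)
    have \<phi>R': "Y' < \<bar>\<phi> (rp R)\<bar>" unfolding \<phi>R Y'_def using False by simp
    then have \<phi>R0: "\<phi> (rp R) \<noteq> 0" using pos by auto
    \<comment> \<open>Subtracting \<open>s\<close> times \<open>R\<close> makes the value at \<xi>
      vanish, so the coefficients in \<open>I\<close> control the rest. Since \<open>R\<close> is
      larger than \<open>Y'\<close> at \<xi>, the factor \<open>s\<close> is at most 1 and the
      height stays comparable to \<open>X\<close>.\<close>
    define s where "s = \<phi> (rp P) / \<phi> (rp R)"
    have s1: "\<bar>s\<bar> \<le> 1" using \<phi>P \<phi>R' \<phi>R0 by (simp add: s_def abs_divide divide_le_eq_1)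
    define P0' where "P0' = rp P - Polynomial.smult s (rp R)"
    have "rp P \<in> pv.span (rp ` B)" unfolding rpP'
      by (intro pv.span_sum pv.span_scale pv.span_base) auto
    then have "P0' \<in> pv.span (rp ` B)" unfolding P0'_def by (intro pv.span_diff pv.span_scale R)
    moreover have "T P0' = P0'" using \<phi>R0 by (simp add: T_def P0'_def \<phi>_def s_def)
    ultimately have P0'span: "P0' \<in> pv.span (set us)" using Tspan by metis
    have HR: "poly_height (rp R) \<le> X" using height_eq_exp_lh[OF R(1)] R(4) by (simp add: X_def)
    have "poly_height P0' \<le> 3 ^ l * (2 * X)"
    proof (rule I(3)[OF P0'span])
      show "\<forall>i\<in>I. \<bar>coeff P0' i\<bar> \<le> 2 * X"
      proof
        fix i assume "i \<in> I"
        then have "\<bar>coeff (rp P) i\<bar> \<le> X" by (rule coeffP)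
        moreover have "\<bar>s * coeff (rp R) i\<bar> \<le> 1 * X"
          unfolding abs_mult by (intro mult_mono s1 order_trans[OF abs_coeff_le_height HR]) auto
        ultimately show "\<bar>coeff P0' i\<bar> \<le> 2 * X" by (simp add: P0'_def)
      qed
    qed (use pos in simp)
    moreover have "poly_height (rp P) \<le> poly_height P0' + X"
    proof -
      have "rp P = P0' + Polynomial.smult s (rp R)" by (simp add: P0'_def)
      then have "poly_height (rp P) \<le> poly_height P0' + poly_height (Polynomial.smult s (rp R))"
        using height_add by metis
      also have "poly_height (Polynomial.smult s (rp R)) \<le> 1 * X"
        unfolding height_smult by (intro mult_mono s1 HR) auto
      finally show ?thesis by simp
    qed
    moreover have "1 * X \<le> 3 ^ l * X" using pos by (intro mult_right_mono) auto
    ultimately have "poly_height (rp P) \<le> 3 ^ k * X" by (simp add: k_def)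
    also have "3 ^ k * X \<le> (5 * real k) ^ k * X"
      using k1 pos by (intro mult_right_mono power_mono) auto
    also have "\<dots> = exp (x + c)" by (simp add: X_def exp_add c)
    finally have "exp (lh P) \<le> exp (x + c)" using height_eq_exp_lh[OF P0] by simp
    moreover have "y' \<le> lv \<xi> P"
      using \<phi>P abs_eval_eq_exp[OF alg P0] by (simp add: \<phi>_def Y'_def)
    moreover have "degree P \<le> n"
    proof -
      have "degree (Polynomial.smult r b) \<le> n" if "b \<in> B" for r :: int and b
        using degree_smult_le[of r b] Bn[OF that] by linarith
      then show ?thesis unfolding P_def Pt_def by (intro degree_diff_le degree_sum_le B(1)) blast+
    qed
    ultimately show ?thesis using P0 by (intro exI[of _ P]) (auto simp: y'_def)
  qed
qed

text \<open>The constant 22 keeps \<open>m * x\<close> at most 0.32, and exp 0.32 < 1.43.\<close>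

lemma growth_factor_bound:
  assumes n: "22 * d ^ 3 \<le> real n" and d: "d \<ge> 1000"
  shows "(1 + 7 * d\<^sup>2 / (2 * real n)) ^ nat \<lceil>2 * d\<rceil> \<le> 143 / 100"
proof -
  define m where "m = nat \<lceil>2 * d\<rceil>"
  define x where "x = 7 * d\<^sup>2 / (2 * real n)"
  have d3: "d ^ 3 \<ge> 1000 * d\<^sup>2" using mult_right_mono[OF d, of "d\<^sup>2"] by (simp add: power3_eq_cube power2_eq_square)
  have d2: "d\<^sup>2 > 0" using d by simp
  have n0: "real n > 0" using n d3 d2 by linarith
  have x0: "x \<ge> 0" using n0 by (simp add: x_def)
  have m: "real m \<le> 2 * d + 1" using d by (simp add: m_def)
  have "real m * x \<le> (2 * d + 1) * x" using m x0 by (rule mult_right_mono)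
  also have "\<dots> = (14 * d ^ 3 + 7 * d\<^sup>2) / (2 * real n)"
    by (simp add: x_def algebra_simps power3_eq_cube power2_eq_square)
  also have "\<dots> \<le> 32 / 100" using n d3 d2 n0 by (simp add: divide_le_eq)
  finally have mx: "real m * x \<le> 32 / 100" .
  have "(1 + x) ^ m \<le> exp x ^ m" using x0 by (intro power_mono) auto
  also have "\<dots> = exp (real m * x)" by (simp add: exp_of_nat_mult)
  also have "\<dots> \<le> exp (32 / 100)" using mx by simp
  also have "\<dots> \<le> 1 + 32 / 100 + (32 / 100)\<^sup>2" by (rule exp_bound) auto
  also have "\<dots> \<le> 143 / 100" by (simp add: power2_eq_square)
  finally show ?thesis by (simp add: m_def x_def)
qed

text \<open>If all spans had dimension at most \<open>m\<close>, two successive ones would coincide.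
  A polynomial of the lower height then lies in the span of approximations one level better, and the
  pigeonhole principle yields one violating \<open>universal_lower_bound\<close>.\<close>

lemma many_independent_approximations:
  assumes alg: "\<not> algebraic \<xi>" and good: "uniformly_approximable n \<xi> (2 * real n - d)"
    and n: "22 * d ^ 3 \<le> real n" and d: "d \<ge> 1000"
  defines "m \<equiv> nat \<lceil>2 * d\<rceil>"
  shows "\<exists>L0. \<forall>L\<ge>L0. \<exists>B. finite B \<and> card B = Suc m \<and> pv.independent (rp ` B) \<and>
           (\<forall>b\<in>B. degree b \<le> n \<and> lh b \<le> 143 / 100 * L \<and> (2 * real n - d) * L - L \<le> lv \<xi> b)"
proof -
  \<comment> \<open>One step multiplies 2n by \<open>q\<close> to give 2n + 7 d^2, beyond the
    exponent 2n + 6 d^2 of the universal bound.\<close>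
  define q where "q = 1 + 7 * d\<^sup>2 / (2 * real n)"
  have d2: "d\<^sup>2 \<ge> 1000 * d" using mult_right_mono[OF d, of d] d by (simp add: power2_eq_square)
  have d3: "d ^ 3 \<ge> 1000 * d\<^sup>2" using mult_right_mono[OF d, of "d\<^sup>2"] by (simp add: power3_eq_cube power2_eq_square)
  have nd: "real n > d" "real n > 0" using n d3 d2 d by linarith+
  have q1: "q \<ge> 1" by (simp add: q_def)
  have qm: "q ^ m \<le> 143 / 100" unfolding q_def m_def by (rule growth_factor_bound[OF n d])
  have m: "2 * d \<le> real m" "real m \<le> 2 * d + 1" using d by (auto simp: m_def)
  obtain Y0 where Y0: "\<And>Y. Y \<ge> Y0 \<Longrightarrow> \<exists>R. R \<noteq> 0 \<and> degree R \<le> n \<and> lh R \<le> Y \<and> (2 * real n - d) * Y \<le> lv \<xi> R"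
    using good unfolding uniformly_approximable_def by blast
  define \<tau> where "\<tau> = 2 * real n + 6 * d\<^sup>2"
  obtain cu where cu: "cu \<ge> 0" "\<And>P. P \<noteq> 0 \<Longrightarrow> degree P \<le> n \<Longrightarrow> lv \<xi> P \<le> \<tau> * lh P + cu"
    using universal_lower_bound[OF alg good n d] unfolding \<tau>_def by blast
  have \<tau>0: "\<tau> \<ge> 0" by (simp add: \<tau>_def)
  define c where "c = real m * ln (5 * real m)"
  define L0 where "L0 = Max {1, Y0, c + \<tau> * c + cu}"
  have "\<exists>B. finite B \<and> card B = Suc m \<and> pv.independent (rp ` B) \<and>
           (\<forall>b\<in>B. degree b \<le> n \<and> lh b \<le> 143 / 100 * L \<and> (2 * real n - d) * L - L \<le> lv \<xi> b)"
    if LL: "L \<ge> L0" for L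
  proof (rule ccontr)
    assume neg: "\<not> ?thesis"
    have L: "L \<ge> 1" "L \<ge> Y0" "L \<ge> c + \<tau> * c + cu" using LL by (auto simp: L0_def)
    \<comment> \<open>All levels share the height bound \<open>q ^ m * L\<close>; only the required
      order grows with \<open>j\<close>, so the sets decrease.\<close>
    define G where "G j = {P. P \<noteq> 0 \<and> degree P \<le> n \<and> lh P \<le> q ^ m * L \<and> (2 * real n - d) * (q ^ j * L) - L \<le> lv \<xi> P}" for j
    have finG: "finite (G j)" for j
    proof (rule finite_subset)
      show "G j \<subseteq> {P. degree P \<le> n \<and> poly_height (rp P) \<le> exp (q ^ m * L)}"
        by (auto simp: G_def height_eq_exp_lh)
    qed (rule finite_bounded_height)
    have Gmono: "G (Suc j) \<subseteq> G j" for j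
    proof -
      have "(2 * real n - d) * (q ^ j * L) \<le> (2 * real n - d) * (q ^ Suc j * L)"
        using nd L q1 by (intro mult_left_mono mult_right_mono power_increasing) auto
      then show ?thesis by (auto simp: G_def)
    qed
    have G0: "G j \<subseteq> G 0" for j by (rule lift_Suc_antimono_le[of G]) (use Gmono in auto)
    have "\<forall>j. \<exists>C. C \<subseteq> rp ` G j \<and> pv.independent C \<and> rp ` G j \<subseteq> pv.span C"
      using pv.maximal_independent_subset by metis
    then obtain C where C: "\<And>j. C j \<subseteq> rp ` G j" "\<And>j. pv.independent (C j)" "\<And>j. rp ` G j \<subseteq> pv.span (C j)"
      by metis
    have finC: "finite (C j)" for j using C(1) finG finite_subset by blast
    have lift: "\<exists>B. B \<subseteq> G j \<and> finite B \<and> card B = card K \<and> rp ` B = K" if "K \<subseteq> C j" for j K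
    proof -
      have K: "K \<subseteq> rp ` G j" using that C(1) by blast
      then obtain B where B: "B \<subseteq> G j" "K = rp ` B" by (auto simp: subset_image_iff)
      have "card K = card B" unfolding B(2) by (rule card_image) (simp add: inj_on_def)
      moreover have "finite B" using B(1) finG finite_subset by blast
      ultimately show ?thesis using B by (intro exI[of _ B]) simp
    qed
    have cardC: "card (C j) \<le> m" for j
    proof (rule ccontr)
      assume "\<not> card (C j) \<le> m"
      then obtain K where K: "K \<subseteq> C j" "card K = Suc m" by (metis Suc_leI not_le obtain_subset_with_card_n)
      obtain B where B: "B \<subseteq> G j" "finite B" "card B = card K" "rp ` B = K" using lift[OF K(1)] by blast
      have "pv.independent (rp ` B)" using B(4) K(1) C(2) pv.independent_mono by blast
      moreover have "degree b \<le> n \<and> lh b \<le> 143 / 100 * L \<and> (2 * real n - d) * L - L \<le> lv \<xi> b" if "b \<in> B" for b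
      proof -
        have "b \<in> G 0" using that B(1) G0 by blast
        moreover have "q ^ m * L \<le> 143 / 100 * L" using qm L by (intro mult_right_mono) auto
        ultimately show ?thesis by (auto simp: G_def)
      qed
      ultimately show False using neg B K by metis
    qed
    have RG: "\<exists>R. R \<in> G j \<and> lh R \<le> q ^ j * L" if "j \<le> m" for j
    proof -
      have "1 * L \<le> q ^ j * L" using q1 L by (intro mult_right_mono one_le_power) auto
      then have "Y0 \<le> q ^ j * L" using L by linarith
      then obtain R where R: "R \<noteq> 0" "degree R \<le> n" "lh R \<le> q ^ j * L" "(2 * real n - d) * (q ^ j * L) \<le> lv \<xi> R"
        using Y0 by blast
      moreover have "q ^ j * L \<le> q ^ m * L" using q1 L that by (intro mult_right_mono power_increasing) auto
      ultimately have "lh R \<le> q ^ m * L" "(2 * real n - d) * (q ^ j * L) - L \<le> lv \<xi> R"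
        using L by linarith+
      then show ?thesis using R by (intro exI[of _ R]) (simp add: G_def)
    qed
    have C1: "card (C m) \<ge> 1"
    proof -
      obtain R where R: "R \<in> G m" using RG by blast
      then have "rp R \<in> pv.span (C m)" "rp R \<noteq> 0" using C(3) by (auto simp: G_def)
      then have "C m \<noteq> {}" by (auto simp: pv.span_empty)
      then show ?thesis using finC card_gt_0_iff by (metis One_nat_def Suc_leI)
    qed
    have cardmono: "card (C (Suc j)) \<le> card (C j)" for j
    proof -
      have "C (Suc j) \<subseteq> pv.span (C j)" using C(1)[of "Suc j"] Gmono[of j] C(3)[of j] by blast
      then show ?thesis using pv.independent_span_bound[OF finC C(2)] by blast
    qed
    \<comment> \<open>The dimension starts at no more than \<open>m\<close> and ends at 1 or more,
      so it cannot drop at each of the \<open>m\<close> steps.\<close>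
    obtain j where j: "j < m" "card (C j) \<le> card (C (Suc j))"
    proof (rule ccontr)
      assume "\<not> thesis"
      then have dec: "card (C (Suc j)) < card (C j)" if "j < m" for j using that \<open>\<And>j. \<lbrakk>j < m; card (C j) \<le> card (C (Suc j))\<rbrakk> \<Longrightarrow> thesis\<close> not_le by blast
      have "card (C j) + j \<le> m" if "j \<le> m" for j
        using that
      proof (induction j)
        case 0
        then show ?case using cardC by simp
      next
        case (Suc j)
        then show ?case using dec[of j] by simp
      qed
      then show False using C1 by fastforce
    qed
    have sub: "C j \<subseteq> pv.span (C (Suc j))"
    proof (rule ccontr)
      assume "\<not> ?thesis"
      then obtain p where p: "p \<in> C j" "p \<notin> pv.span (C (Suc j))" by blast
      have ind: "pv.independent (insert p (C (Suc j)))" using pv.independent_insertI[OF p(2) C(2)] .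
      have "insert p (C (Suc j)) \<subseteq> pv.span (C j)"
        using p(1) pv.span_base[of p "C j"] C(1)[of "Suc j"] Gmono[of j] C(3)[of j] by blast
      then have "card (insert p (C (Suc j))) \<le> card (C j)" using pv.independent_span_bound[OF finC ind] by blast
      moreover have "p \<notin> C (Suc j)" using p(2) pv.span_base by blast
      ultimately show False using j(2) finC[of "Suc j"] by simp
    qed
    obtain R where R: "R \<in> G j" "lh R \<le> q ^ j * L" using RG[of j] j(1) by auto
    obtain B where B: "B \<subseteq> G (Suc j)" "finite B" "card B = card (C (Suc j))" "rp ` B = C (Suc j)"
      using lift[OF subset_refl] by blast
    have "rp R \<in> pv.span (C j)" using R C(3) by blast
    then have Rspan: "rp R \<in> pv.span (rp ` B)"
      using pv.span_minimal[OF sub pv.subspace_span] B(4) by auto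
    have "rp R \<noteq> 0" using R by (auto simp: G_def)
    then have "B \<noteq> {}" using Rspan by (auto simp: pv.span_empty)
    then obtain l where l: "card B = Suc l" using B(2) by (metis card_gt_0_iff gr0_implies_Suc)
    have lm: "Suc l \<le> m" using l B(3) cardC by metis
    have jm: "q ^ j * L \<le> q ^ m * L" using q1 L j(1) by (intro mult_right_mono power_increasing) auto
    define c' where "c' = real (Suc l) * ln (5 * real (Suc l))"
    have c': "0 \<le> c'" "c' \<le> c" using lm unfolding c'_def c_def by (auto intro!: mult_mono)
    \<comment> \<open>The basis comes from level \<open>j + 1\<close>, while \<open>R\<close> has
      only the height of level \<open>j\<close>: the result has height about
      \<open>q ^ j * L\<close> but nearly the order of level \<open>j + 1\<close>.\<close>
    have "\<exists>P. P \<noteq> 0 \<and> degree P \<le> n \<and> lh P \<le> q ^ j * L + c' \<and>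
      ((2 * real n - d) * (q ^ Suc j * L) - L) - real l * (q ^ m * L - q ^ j * L) - c' \<le> lv \<xi> P"
      unfolding c'_def
      by (rule short_polynomial_by_pigeonhole[OF alg B(2) l _ _ _ _ _ Rspan])
         (use B C(2)[of "Suc j"] R jm in \<open>auto simp: G_def\<close>)
    then obtain P where P: "P \<noteq> 0" "degree P \<le> n" "lh P \<le> q ^ j * L + c'"
      "((2 * real n - d) * (q ^ Suc j * L) - L) - real l * (q ^ m * L - q ^ j * L) - c' \<le> lv \<xi> P" by blast
    have "lv \<xi> P \<le> \<tau> * (q ^ j * L + c) + cu"
      using cu(2)[OF P(1,2)] mult_left_mono[of "lh P" "q ^ j * L + c" \<tau>] P(3) c' \<tau>0 by linarith
    moreover have "real l * (q ^ m * L - q ^ j * L) \<le> real m * (q ^ m * L - q ^ j * L)"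
      using jm lm by (intro mult_right_mono) auto
    moreover have "\<tau> * (q ^ j * L + c) = \<tau> * (q ^ j * L) + \<tau> * c" by (simp add: algebra_simps)
    ultimately have "(2 * real n - d) * (q ^ Suc j * L) - real m * (q ^ m * L - q ^ j * L) \<le> \<tau> * (q ^ j * L) + 2 * L"
      using P(4) c' L(3) by linarith
    moreover define x where "x = q ^ j"
    ultimately have "L * ((2 * real n - d) * (q * x) - real m * (q ^ m - x)) \<le> L * (\<tau> * x + 2)"
      by (simp add: algebra_simps)
    then have *: "(2 * real n - d) * (q * x) - real m * (q ^ m - x) \<le> \<tau> * x + 2" using L by simp
    have x1: "x \<ge> 1" using q1 by (simp add: x_def)
    have "real m * (q ^ m - x) \<le> real m * x" using qm x1 by (intro mult_left_mono) auto
    then have "((2 * real n - d) * q) * x \<le> (\<tau> + real m + 2) * x" using * x1 by (simp add: algebra_simps)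
    then have "(2 * real n - d) * q \<le> \<tau> + real m + 2" using x1 by simp
    \<comment> \<open>The left side is at least 2n + 7 d^2 - d - 1, the bound just found at most 2n
      + 6 d^2 + 2d + 3.\<close>
    moreover have "(2 * real n - d) * q = 2 * real n - d + 7 * d\<^sup>2 - 7 * d ^ 3 / (2 * real n)"
      using nd by (simp add: q_def field_simps power3_eq_cube power2_eq_square)
    moreover have "7 * d ^ 3 / (2 * real n) \<le> 1" using n nd d3 d2 d by (simp add: divide_le_eq)
    ultimately show False using m d2 d by (simp add: \<tau>_def)
  qed
  then show ?thesis by blast
qed

section \<open>Spaces spanned by multiples\<close>

lemma subspace_bounded_degree: "pv.subspace {p. degree p \<le> N}"
  by (rule pv.subspaceI) (auto intro: degree_add_le order_trans[OF degree_smult_le])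

lemma independent_monoms:
  "pv.independent (monom 1 ` {..N})" "card (monom 1 ` {..N} :: real poly set) = Suc N"
proof -
  have *: "\<forall>i\<in>{..N}. c i = 0" if "(\<Sum>i\<in>{..N}. Polynomial.smult (c i) (monom 1 i)) = (0 :: real poly)" for c
  proof
    fix i assume i: "i \<in> {..N}"
    have "coeff (\<Sum>j\<in>{..N}. Polynomial.smult (c j) (monom 1 j)) i = c i"
      using i by (simp add: coeff_sum if_distrib cong: if_cong)
    then show "c i = 0" using that by simp
  qed
  have "inj_on (monom (1::real)) {..N}" "pv.independent (monom 1 ` {..N})"
    using family_independent[of "{..N}" "monom 1", OF finite_atMost *] by auto
  then show "pv.independent (monom 1 ` {..N})" "card (monom 1 ` {..N} :: real poly set) = Suc N"
    by (auto simp: card_image)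
qed

lemma span_monoms: "pv.span (monom 1 ` {..N}) = {p. degree p \<le> N}"
proof
  show "pv.span (monom 1 ` {..N}) \<subseteq> {p. degree p \<le> N}"
    by (rule pv.span_minimal[OF _ subspace_bounded_degree]) (auto intro: order_trans[OF degree_monom_le])
  show "{p. degree p \<le> N} \<subseteq> pv.span (monom 1 ` {..N})"
  proof
    fix p :: "real poly" assume "p \<in> {p. degree p \<le> N}"
    then have "p = (\<Sum>i\<le>N. monom (coeff p i) i)" by (simp add: poly_as_sum_of_monoms')
    also have "\<dots> = (\<Sum>i\<le>N. Polynomial.smult (coeff p i) (monom 1 i))" by (simp add: smult_monom)
    also have "\<dots> \<in> pv.span (monom 1 ` {..N})" by (intro pv.span_sum pv.span_scale pv.span_base) auto
    finally show "p \<in> pv.span (monom 1 ` {..N})" .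
  qed
qed

lemma independent_bounded_degree_card:
  assumes "pv.independent S" "S \<subseteq> {p. degree p \<le> N}"
  shows "finite S" "card S \<le> Suc N"
  using pv.independent_span_bound[of "monom 1 ` {..N}" S] assms independent_monoms(2)[of N]
  by (auto simp: span_monoms)

lemma spanning_bounded_degree_card:
  assumes "finite S" "{p. degree p \<le> N} \<subseteq> pv.span S"
  shows "Suc N \<le> card S"
proof -
  have "monom (1::real) ` {..N} \<subseteq> pv.span S"
    using assms(2) by (auto intro: order_trans[OF degree_monom_le])
  then show ?thesis
    using pv.independent_span_bound[OF assms(1) independent_monoms(1)[of N]] independent_monoms(2)[of N] by auto
qed

text \<open>A space of polynomials of degree at most \<open>N\<close> that is stable under multiplication by \<open>X\<close>
  as far as the degree permits consists of the multiples of its element of least degree.\<close>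

lemma shift_closed_subspace_full:
  fixes P Q :: "real poly"
  assumes A: "pv.subspace A" "A \<subseteq> {p. degree p \<le> N}"
    and closed: "\<And>p. p \<in> A \<Longrightarrow> degree p < N \<Longrightarrow> monom 1 1 * p \<in> A"
    and PQ: "P \<in> A" "Q \<in> A" "P \<noteq> 0" and UV: "U * P + V * Q = [:c:]" "c \<noteq> 0"
  shows "{p. degree p \<le> N} \<subseteq> A"
proof -
  obtain g where g: "g \<in> A \<and> g \<noteq> 0" and min: "\<And>p. p \<in> A \<and> p \<noteq> 0 \<Longrightarrow> degree g \<le> degree p"
    using ex_has_least_nat[of "\<lambda>p. p \<in> A \<and> p \<noteq> 0" P degree] PQ by blast
  have shift: "monom 1 i * g \<in> A" if "i + degree g \<le> N" for i
    using that
  proof (induction i)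
    case 0
    then show ?case using g by simp
  next
    case (Suc i)
    have "degree (monom 1 i * g) = i + degree g"
      using g by (subst degree_mult_eq) (auto simp: degree_monom_eq monom_eq_0_iff)
    then have "monom 1 1 * (monom 1 i * g) \<in> A" using Suc by (intro closed) auto
    also have "monom 1 1 * (monom 1 i * g) = monom 1 (Suc i) * g"
      by (simp add: mult.assoc[symmetric] mult_monom)
    finally show ?case .
  qed
  have mult: "f * g \<in> A" if "degree (f * g) \<le> N" for f
  proof (cases "f = 0")
    case True
    then show ?thesis using pv.subspace_0[OF A(1)] by simp
  next
    case False
    then have deg: "degree f + degree g \<le> N" using that g by (simp add: degree_mult_eq)
    have "f * g = (\<Sum>i\<le>degree f. monom (coeff f i) i) * g" by (simp add: poly_as_sum_of_monoms)
    also have "\<dots> = (\<Sum>i\<le>degree f. Polynomial.smult (coeff f i) (monom 1 i * g))"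
      unfolding sum_distrib_right by (intro sum.cong) (auto simp: smult_monom mult_smult_left[symmetric])
    also have "\<dots> \<in> A"
      by (intro pv.subspace_sum[OF A(1)] pv.subspace_scale[OF A(1)] shift) (use deg in auto)
    finally show ?thesis .
  qed
  \<comment> \<open>Division by \<open>g\<close> stays inside \<open>A\<close>, and a nonzero
    remainder would have smaller degree than \<open>g\<close>.\<close>
  have dvd: "g dvd p" if p: "p \<in> A" for p
  proof -
    have eq: "p div g * g = p - p mod g" by (simp add: minus_mod_eq_div_mult)
    have "degree (p mod g) \<le> N"
      using degree_mod_less'[of g p] g A(2) by (cases "p mod g = 0") auto
    then have "degree (p div g * g) \<le> N" unfolding eq using p A(2) by (intro degree_diff_le) auto
    then have "p div g * g \<in> A" by (rule mult)
    then have "p - p div g * g \<in> A" using p pv.subspace_diff[OF A(1)] by blast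
    then have "p mod g \<in> A" by (simp add: minus_div_mult_eq_mod)
    then have "p mod g = 0" using min[of "p mod g"] degree_mod_less'[of g p] g by force
    then show ?thesis by auto
  qed
  \<comment> \<open>The Bezout relation makes \<open>g\<close> constant, so its multiples exhaust
    the polynomials of degree at most \<open>N\<close>.\<close>
  have "g dvd U * P + V * Q" by (intro dvd_add dvd_mult dvd PQ)
  then have "g dvd [:c:]" by (simp only: UV)
  then have "degree g \<le> degree [:c:]" by (rule dvd_imp_degree_le) (use UV(2) in simp)
  then have "degree g = 0" by simp
  then obtain a where a: "g = [:a:]" by (metis degree_eq_zeroE)
  have a0: "a \<noteq> 0" using a g by auto
  show ?thesis
  proof
    fix p :: "real poly" assume p: "p \<in> {p. degree p \<le> N}"
    have eq: "Polynomial.smult (1 / a) p * g = p" using a a0 by simp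
    have "Polynomial.smult (1 / a) p * g \<in> A" by (rule mult) (use p eq in simp)
    then show "p \<in> A" using eq by simp
  qed
qed

text \<open>Until the span is full, each further shift raises the dimension by at least two, while
  the ambient dimension grows only by one. The initial deficit is at most \<open>n - m\<close>,
  hence \<open>k\<close> shifts suffice.\<close>

lemma shifts_span_full:
  fixes B :: "real poly set"
  assumes B: "pv.independent B" "\<And>b. b \<in> B \<Longrightarrow> degree b \<le> n" "Suc m \<le> card B"
    and PQ: "P \<in> B" "Q \<in> B" "degree P = n" "n > 0" and UV: "U * P + V * Q = [:c:]" "c \<noteq> 0"
    and k: "n \<le> k + m"
  shows "{p. degree p \<le> n + k} \<subseteq> pv.span {monom 1 i * b | i b. i \<le> k \<and> b \<in> B}"
proof -
  define G where "G k = {monom 1 i * b | i b. i \<le> k \<and> b \<in> B}" for k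
  have P0: "P \<noteq> 0" using PQ by auto
  have finB: "finite B" using independent_bounded_degree_card(1)[OF B(1), of n] B(2) by auto
  have Gdeg: "G k \<subseteq> {p. degree p \<le> n + k}" for k
  proof
    fix p assume "p \<in> G k"
    then obtain i b where p: "p = monom 1 i * b" "i \<le> k" "b \<in> B" by (auto simp: G_def)
    have "degree p \<le> degree (monom (1::real) i) + degree b" unfolding p(1) by (rule degree_mult_le)
    then show "p \<in> {p. degree p \<le> n + k}" using p B(2)[of b] degree_monom_le[of "1::real" i] by simp
  qed
  have spandeg: "pv.span (G k) \<subseteq> {p. degree p \<le> n + k}" for k
    by (rule pv.span_minimal[OF Gdeg subspace_bounded_degree])
  have Gmono: "pv.span (G k) \<subseteq> pv.span (G (Suc k))" for k
    by (rule pv.span_mono) (auto simp: G_def intro: le_SucI)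
  have shift: "monom 1 1 * p \<in> pv.span (G (Suc k))" if "p \<in> pv.span (G k)" for p k
  proof -
    have "pv.subspace {p. monom 1 1 * p \<in> pv.span (G (Suc k))}"
      by (rule pv.subspaceI) (auto simp: pv.span_zero distrib_left intro: pv.span_add pv.span_scale)
    moreover have "G k \<subseteq> {p. monom 1 1 * p \<in> pv.span (G (Suc k))}"
    proof clarify
      fix p assume "p \<in> G k"
      then obtain i b where p: "p = monom 1 i * b" "i \<le> k" "b \<in> B" by (auto simp: G_def)
      have "monom 1 1 * p = monom 1 (Suc i) * b" unfolding p(1) by (simp add: mult.assoc[symmetric] mult_monom)
      moreover have "Suc i \<le> Suc k" using p(2) by simp
      ultimately have "monom 1 1 * p \<in> G (Suc k)" unfolding G_def using p(3) by blast
      then show "monom 1 1 * p \<in> pv.span (G (Suc k))" by (rule pv.span_base)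
    qed
    ultimately have "pv.span (G k) \<subseteq> {p. monom 1 1 * p \<in> pv.span (G (Suc k))}" by (intro pv.span_minimal)
    then show ?thesis using that by blast
  qed
  have PQG: "P \<in> G k" "Q \<in> G k" for k
  proof -
    have "b \<in> G k" if "b \<in> B" for b
    proof -
      have "b = monom 1 0 * b" by (simp add: monom_0)
      then show ?thesis unfolding G_def using that by blast
    qed
    then show "P \<in> G k" "Q \<in> G k" using PQ by auto
  qed
  have claim: "{p. degree p \<le> n + k} \<subseteq> pv.span (G k) \<or>
     (\<exists>S. finite S \<and> S \<subseteq> pv.span (G k) \<and> pv.independent S \<and> Suc m + 2 * k \<le> card S)" for k
  proof (induction k)
    case 0
    have "B \<subseteq> G 0" by (force simp: G_def)
    then have "B \<subseteq> pv.span (G 0)" using pv.span_superset by blast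
    then show ?case using B finB by auto
  next
    case (Suc k)
    show ?case
    proof (cases "{p. degree p \<le> n + k} \<subseteq> pv.span (G k)")
      case True
      have "p \<in> pv.span (G (Suc k))" if p: "degree p \<le> n + Suc k" for p
      proof -
        obtain a p' where ap: "p = pCons a p'" by (cases p)
        have "degree p' \<le> n + k" using p ap by (cases "p' = 0") auto
        then have "monom 1 1 * p' \<in> pv.span (G (Suc k))" using True shift by blast
        moreover have "[:a:] \<in> pv.span (G (Suc k))" using True Gmono by fastforce
        moreover have "p = [:a:] + monom 1 1 * p'" using ap by (simp add: monom_Suc monom_0)
        ultimately show ?thesis using pv.span_add by metis
      qed
      then show ?thesis by blast
    next
      case False
      then obtain S where S: "finite S" "S \<subseteq> pv.span (G k)" "pv.independent S" "Suc m + 2 * k \<le> card S"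
        using Suc.IH by blast
      \<comment> \<open>First new direction: without it the old span would be closed under
        admissible multiplication by X and so be full by
        \<open>shift_closed_subspace_full\<close>.\<close>
      have "\<exists>w. w \<in> pv.span (G (Suc k)) \<and> degree w \<le> n + k \<and> w \<notin> pv.span (G k)"
      proof (rule ccontr)
        assume neg: "\<not> ?thesis"
        have "{p. degree p \<le> n + k} \<subseteq> pv.span (G k)"
        proof (rule shift_closed_subspace_full[OF pv.subspace_span spandeg _ _ _ P0 UV])
          show "monom 1 1 * p \<in> pv.span (G k)" if "p \<in> pv.span (G k)" "degree p < n + k" for p
          proof -
            have "degree (monom 1 1 * p) \<le> n + k"
              using degree_mult_le[of "monom 1 1" p] degree_monom_le[of "1::real" 1] that(2) by linarith
            then show ?thesis using neg shift[OF that(1)] by blast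
          qed
        qed (use PQG pv.span_base in blast)+
        then show False using False by simp
      qed
      then obtain w where w: "w \<in> pv.span (G (Suc k))" "degree w \<le> n + k" "w \<notin> pv.span (G k)" by blast
      have Sspan: "pv.span S \<subseteq> pv.span (G k)" using S(2) by (rule pv.span_minimal) simp
      have ind1: "pv.independent (insert w S)" using w(3) Sspan S(3) by (intro pv.independent_insertI) auto
      \<comment> \<open>Second new direction, independent of the others because its degree is
        larger.\<close>
      define z where "z = monom 1 (Suc k) * P"
      have zdeg: "degree z = n + Suc k"
        using P0 PQ(3) by (simp add: z_def degree_mult_eq degree_monom_eq monom_eq_0_iff)
      have "insert w S \<subseteq> {p. degree p \<le> n + k}" using w(2) S(2) spandeg by blast
      then have "pv.span (insert w S) \<subseteq> {p. degree p \<le> n + k}"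
        by (rule pv.span_minimal[OF _ subspace_bounded_degree])
      then have znot: "z \<notin> pv.span (insert w S)" using zdeg by auto
      have ind2: "pv.independent (insert z (insert w S))" by (rule pv.independent_insertI[OF znot ind1])
      have "w \<notin> S" using w(3) S(2) by blast
      moreover have "z \<notin> insert w S" using znot pv.span_base by blast
      ultimately have "card (insert z (insert w S)) = Suc (Suc (card S))" using S(1) by simp
      moreover have "z \<in> G (Suc k)" using PQ(1) unfolding z_def G_def by blast
      then have "insert z (insert w S) \<subseteq> pv.span (G (Suc k))"
        using w(1) S(2) Gmono pv.span_base by blast
      ultimately show ?thesis using S(1,4) ind2
        by (intro disjI2 exI[of _ "insert z (insert w S)"]) auto
    qed
  qed
  have "{p. degree p \<le> n + k} \<subseteq> pv.span (G k)"
  proof (rule ccontr)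
    assume neg: "\<not> ?thesis"
    then obtain S where S: "finite S" "S \<subseteq> pv.span (G k)" "pv.independent S" "Suc m + 2 * k \<le> card S"
      using claim by blast
    obtain p where p: "degree p \<le> n + k" "p \<notin> pv.span (G k)" using neg by blast
    have "pv.span S \<subseteq> pv.span (G k)" using S(2) by (rule pv.span_minimal) simp
    then have "pv.independent (insert p S)" using p(2) S(3) by (intro pv.independent_insertI) auto
    moreover have "insert p S \<subseteq> {p. degree p \<le> n + k}" using p S(2) spandeg by blast
    ultimately have "card (insert p S) \<le> Suc (n + k)" by (rule independent_bounded_degree_card(2))
    moreover have "p \<notin> S" using p(2) S(2) by blast
    ultimately show False using S(1,4) k by simp
  qed
  then show ?thesis by (simp only: G_def)
qed

section \<open>The upper bound for the uniform exponent\<close>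

lemma exponent_le_2n:
  assumes alg: "\<not> algebraic \<xi>" and good: "uniformly_approximable n \<xi> w"
  shows "w \<le> 2 * real n"
proof (rule ccontr)
  assume "\<not> ?thesis"
  define w' where "w' = (w + 2 * real n) / 2"
  have w': "2 * real n < w'" "0 \<le> w'" "w' < w" using \<open>\<not> w \<le> 2 * real n\<close> by (auto simp: w'_def)
  define c where "c = 2 * real n * \<bar>ln \<bar>\<xi>\<bar>\<bar> + ln (fact (2 * n + 1))"
  obtain Q P where QP: "prime_elem Q" "0 < degree Q" "degree Q \<le> n" "(c + 1) / (w' - 2 * real n) \<le> lh Q"
    "w' * lh Q \<le> lv \<xi> Q" "P \<noteq> 0" "degree P \<le> n" "lh P \<le> lh Q" "w' * lh Q \<le> lv \<xi> P" "\<not> Q dvd P"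
    using base_pair[OF alg good w'(2,3)] by blast
  have Q0: "lh Q \<ge> 0" using QP(2) by (intro lh_nonneg) auto
  have "w' * lh Q \<le> min (lv \<xi> P) (lv \<xi> Q)" using QP by simp
  also have "\<dots> \<le> degree P * lh Q + degree Q * lh P + c"
    unfolding c_def by (rule resultant_inequality[OF alg QP(1,2,3,10,7)])
  also have "degree P * lh Q \<le> real n * lh Q" using QP Q0 by (intro mult_right_mono) auto
  also have "degree Q * lh P \<le> real n * lh Q" using QP Q0 by (intro mult_mono lh_nonneg) auto
  finally have "(w' - 2 * real n) * lh Q \<le> c" by (simp add: algebra_simps)
  moreover have "(w' - 2 * real n) * ((c + 1) / (w' - 2 * real n)) \<le> (w' - 2 * real n) * lh Q"
    using w' QP(4) by (intro mult_left_mono) auto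
  ultimately show False using w' by simp
qed

lemma uniformly_approximable_mono:
  assumes "uniformly_approximable n \<xi> w" "w' \<le> w"
  shows "uniformly_approximable n \<xi> w'"
proof -
  obtain Y0 where Y0: "\<And>Y. Y \<ge> Y0 \<Longrightarrow> \<exists>R. R \<noteq> 0 \<and> degree R \<le> n \<and> lh R \<le> Y \<and> w * Y \<le> lv \<xi> R"
    using assms(1) unfolding uniformly_approximable_def by blast
  have "\<exists>R. R \<noteq> 0 \<and> degree R \<le> n \<and> lh R \<le> Y \<and> w' * Y \<le> lv \<xi> R" if "Y \<ge> max 0 Y0" for Y
  proof -
    obtain R where "R \<noteq> 0" "degree R \<le> n" "lh R \<le> Y" "w * Y \<le> lv \<xi> R" using Y0[of Y] \<open>Y \<ge> max 0 Y0\<close> by auto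
    moreover have "w' * Y \<le> w * Y" using assms(2) that by (intro mult_right_mono) auto
    ultimately show ?thesis by (intro exI[of _ R]) auto
  qed
  then show ?thesis unfolding uniformly_approximable_def by blast
qed

text \<open>With \<open>k = n - m\<close> the determinant has size n + k + 1 = 2n - m + 1. Of its
  polynomials 2(k + 1) have logarithmic height at most \<open>L\<close>, and the other
  \<open>m - 1\<close> at most 1.43 L.\<close>

lemma exponent_le_2n_minus_d:
  assumes alg: "\<not> algebraic \<xi>" and good: "uniformly_approximable n \<xi> w"
    and n: "22 * d ^ 3 \<le> real n" and d: "d \<ge> 1000"
  shows "w \<le> 2 * real n - d"
proof (rule ccontr)
  assume w: "\<not> ?thesis"
  define m where "m = nat \<lceil>2 * d\<rceil>"
  have m: "2 * d \<le> real m" "real m \<le> 2 * d + 1" using d by (auto simp: m_def)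
  have d2: "d\<^sup>2 \<ge> 1000 * d" using mult_right_mono[OF d, of d] d by (simp add: power2_eq_square)
  have d3: "d ^ 3 \<ge> 1000 * d\<^sup>2" using mult_right_mono[OF d, of "d\<^sup>2"] by (simp add: power3_eq_cube power2_eq_square)
  have nd: "real n > 2 * d + 1" "n > 0" using n d3 d2 d by linarith+
  have mn: "m \<le> n" "m \<ge> 1" using m nd d by linarith+
  define k where "k = n - m"
  have kn: "k + m = n" "Suc k \<le> n" using mn by (auto simp: k_def)
  define w0 where "w0 = 2 * real n - d"
  have w0: "0 \<le> w0" "w0 < w" using w nd d by (auto simp: w0_def)
  have good0: "uniformly_approximable n \<xi> (2 * real n - d)"
    by (rule uniformly_approximable_mono[OF good]) (use w0 in \<open>simp add: w0_def\<close>)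
  obtain L1 where L1: "\<And>L. L \<ge> L1 \<Longrightarrow> \<exists>B. finite B \<and> card B = Suc m \<and> pv.independent (rp ` B) \<and>
      (\<forall>b\<in>B. degree b \<le> n \<and> lh b \<le> 143 / 100 * L \<and> w0 * L - L \<le> lv \<xi> b)"
    using many_independent_approximations[OF alg good0 n d] unfolding m_def w0_def by blast
  obtain c1 where c1: "c1 \<ge> 0"
    "\<And>A B. A \<noteq> 0 \<Longrightarrow> B \<noteq> 0 \<Longrightarrow> degree A \<le> n \<Longrightarrow> degree B \<le> n \<Longrightarrow> lh A + lh B \<le> lh (A * B) + c1"
    using gelfond[of n] by blast
  define K where "K = real n * \<bar>ln \<bar>\<xi>\<bar>\<bar>"
  define c2 where "c2 = 2 * K + ln (fact (Suc (n + k)))"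
  obtain Q P where QP: "prime_elem Q" "0 < degree Q" "degree Q \<le> n" "Max {1, L1, c1 + 1, c2} \<le> lh Q"
    "w0 * lh Q \<le> lv \<xi> Q" "P \<noteq> 0" "degree P \<le> n" "lh P \<le> lh Q" "w0 * lh Q \<le> lv \<xi> P" "\<not> Q dvd P"
    using base_pair[OF alg good w0] by blast
  define L where "L = lh Q"
  have L: "L \<ge> 1" "L \<ge> L1" "L \<ge> c1 + 1" "L \<ge> c2" using QP(4) by (auto simp: L_def)
  have Q0: "Q \<noteq> 0" using QP(2) by auto
  have K0: "K \<ge> 0" by (simp add: K_def)
  \<comment> \<open>The shift gives degree exactly \<open>n\<close>, as
    \<open>shifts_span_full\<close> requires, without changing the height.\<close>
  define P' where "P' = monom 1 (n - degree P) * P"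
  have P'0: "P' \<noteq> 0" using QP(6) by (simp add: P'_def monom_eq_0_iff)
  have P'deg: "degree P' = n"
    using QP(6,7) by (simp add: P'_def degree_mult_eq degree_monom_eq monom_eq_0_iff)
  have P'h: "lh P' \<le> L" using QP(8) by (simp add: P'_def lh_monom_mult L_def)
  have P'v: "w0 * L - K \<le> lv \<xi> P'"
    using lv_monom_mult[OF alg QP(6), of "n - degree P" n] QP(9) unfolding P'_def K_def L_def by linarith
  \<comment> \<open>If the prime \<open>Q\<close> divided a power of X, Gelfond's inequality would
    bound its height.\<close>
  have QP': "\<not> Q dvd P'"
  proof
    assume "Q dvd P'"
    then have "Q dvd monom 1 (n - degree P)"
      using QP(1,10) prime_elem_dvd_mult_iff unfolding P'_def by blast
    then obtain S where S: "monom 1 (n - degree P) = Q * S" by blast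
    have S0: "S \<noteq> 0"
    proof
      assume "S = 0"
      then show False using S by (simp add: monom_eq_0_iff)
    qed
    have "n - degree P = degree Q + degree S"
      using arg_cong[OF S, of degree] Q0 S0 by (simp add: degree_mult_eq degree_monom_eq)
    then have "lh Q + lh S \<le> lh (Q * S) + c1" using c1(2)[OF Q0 S0 QP(3)] by simp
    also have "lh (Q * S) = lh (monom 1 (n - degree P) * 1)" using S by simp
    also have "\<dots> = 0" unfolding lh_monom_mult by (simp add: lh_def poly_height_def)
    finally show False using L(3) lh_nonneg[OF S0] by (simp add: L_def)
  qed
  obtain U V c where UVc: "U * P' + V * Q = [:c:]" "c \<noteq> 0" using prime_bezout[OF QP(1,2) QP'] .
  have UV: "rp U * rp P' + rp V * rp Q = [:real_of_int c:]" "real_of_int c \<noteq> 0"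
    using arg_cong[OF UVc(1), of rp] UVc(2)
    by (simp_all add: of_int_poly_hom.hom_mult of_int_poly_hom.hom_add map_poly_pCons)
  have rP': "rp P' \<noteq> 0" "degree (rp P') = n" using P'0 P'deg by auto
  obtain B where B: "finite B" "card B = Suc m" "pv.independent (rp ` B)"
    "\<And>b. b \<in> B \<Longrightarrow> degree b \<le> n \<and> lh b \<le> 143 / 100 * L \<and> w0 * L - L \<le> lv \<xi> b"
    using L1[OF L(2)] by blast
  define G where "G = insert P' (insert Q B)"
  have G: "degree b \<le> n" "lh b \<le> 143 / 100 * L" "w0 * L - L - K \<le> lv \<xi> b" if "b \<in> G" for b
  proof -
    have "lh Q = L" by (simp add: L_def)
    then have "degree b \<le> n \<and> lh b \<le> 143 / 100 * L \<and> w0 * L - L - K \<le> lv \<xi> b"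
      using that B(4)[of b] QP(3,5) P'deg P'h P'v L(1) K0 unfolding G_def by fastforce
    then show "degree b \<le> n" "lh b \<le> 143 / 100 * L" "w0 * L - L - K \<le> lv \<xi> b" by auto
  qed
  have PQind: "pv.independent {rp P', rp Q}"
  proof -
    have "pv.independent ((\<lambda>i. if i < 1 then monom 1 i * rp P' else monom 1 (i - 1) * rp Q) ` {..<1 + 1})"
      by (rule coprime_multiples_independent(2)[OF UV]) (use rP' nd in auto)
    moreover have "(\<lambda>i. if i < 1 then monom 1 i * rp P' else monom 1 (i - 1) * rp Q) ` {..<1 + 1} = {rp P', rp Q}"
      by (auto simp: lessThan_Suc numeral_2_eq_2)
    ultimately show ?thesis by simp
  qed
  \<comment> \<open>The coprime pair is kept as part of the basis, so that its many cheap multiples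
    are available.\<close>
  obtain C where C: "{rp P', rp Q} \<subseteq> C" "C \<subseteq> rp ` G" "pv.independent C" "rp ` G \<subseteq> pv.span C"
    by (rule pv.maximal_independent_subset_extend[of "{rp P', rp Q}" "rp ` G"])
       (use PQind in \<open>auto simp: G_def\<close>)
  have finC: "finite C" using C(2) B(1) finite_subset by (auto simp: G_def)
  have cardC: "Suc m \<le> card C"
  proof -
    have "rp ` B \<subseteq> pv.span C" using C(4) by (auto simp: G_def)
    then have "card (rp ` B) \<le> card C" using pv.independent_span_bound[OF finC B(3)] by blast
    moreover have "card (rp ` B) = card B" by (rule card_image) (simp add: inj_on_def)
    ultimately show ?thesis using B(2) by simp
  qed
  define W where "W = {monom 1 i * b | i b. i \<le> k \<and> b \<in> C}"
  have full: "{p. degree p \<le> n + k} \<subseteq> pv.span W"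
    unfolding W_def
    by (rule shifts_span_full[OF C(3) _ cardC _ _ rP'(2) _ UV]) (use C(1,2) G nd kn in auto)
  \<comment> \<open>The cheap multiples; they are independent because k + 1 \<le> n = deg
    P'.\<close>
  define g where "g = (\<lambda>i. if i < Suc k then monom 1 i * rp P' else monom 1 (i - Suc k) * rp Q)"
  have ginj: "inj_on g {..<Suc k + Suc k}" and gind: "pv.independent (g ` {..<Suc k + Suc k})"
    unfolding g_def
    by (rule coprime_multiples_independent[OF UV]; use rP' kn in simp)+
  have gW: "g ` {..<Suc k + Suc k} \<subseteq> W"
  proof clarify
    fix i assume i: "i < Suc k + Suc k"
    show "g i \<in> W"
    proof (cases "i < Suc k")
      case True
      then have "g i = monom 1 i * rp P'" "i \<le> k" by (auto simp: g_def)
      then show ?thesis using C(1) unfolding W_def by blast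
    next
      case False
      then have "g i = monom 1 (i - Suc k) * rp Q" "i - Suc k \<le> k" using i by (auto simp: g_def)
      then show ?thesis using C(1) unfolding W_def by blast
    qed
  qed
  \<comment> \<open>Completion of the cheap multiples to a basis by other shifts, which all come
    from integer polynomials.\<close>
  obtain S where S: "g ` {..<Suc k + Suc k} \<subseteq> S" "S \<subseteq> W" "pv.independent S" "W \<subseteq> pv.span S"
    by (rule pv.maximal_independent_subset_extend[OF gW gind])
  define F where "F = {f. rp f \<in> S}"
  have fW: "\<exists>i b. f = monom 1 i * b \<and> i \<le> k \<and> b \<in> G" if "f \<in> F" for f
  proof -
    have "rp f \<in> W" using that S(2) by (auto simp: F_def)
    then obtain i p where ip: "rp f = monom 1 i * p" "i \<le> k" "p \<in> C" by (auto simp: W_def)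
    then obtain b where b: "b \<in> G" "p = rp b" using C(2) by auto
    have "rp f = rp (monom 1 i * b)" unfolding ip(1) b(2) by (simp add: of_int_poly_hom.hom_mult rp_monom)
    then have "f = monom 1 i * b" by simp
    then show ?thesis using ip b by blast
  qed
  have rpF: "rp ` F = S"
  proof
    show "S \<subseteq> rp ` F"
    proof
      fix p assume p: "p \<in> S"
      then obtain i q where iq: "p = monom 1 i * q" "i \<le> k" "q \<in> C" using S(2) by (auto simp: W_def)
      then obtain b where b: "b \<in> G" "q = rp b" using C(2) by auto
      have "p = rp (monom 1 i * b)" unfolding iq(1) b(2) by (simp add: of_int_poly_hom.hom_mult rp_monom)
      then show "p \<in> rp ` F" using p by (auto simp: F_def)
    qed
  qed (auto simp: F_def)
  have Fdeg: "degree f \<le> n + k" if "f \<in> F" for f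
  proof -
    obtain i b where ib: "f = monom 1 i * b" "i \<le> k" "b \<in> G" using fW[OF \<open>f \<in> F\<close>] by blast
    have "degree f \<le> degree (monom (1::int) i) + degree b" unfolding ib(1) by (rule degree_mult_le)
    then show ?thesis using G(1)[OF ib(3)] ib(2) degree_monom_le[of "1::int" i] by simp
  qed
  have F0: "f \<noteq> 0" if "f \<in> F" for f
  proof
    assume "f = 0"
    then have "0 \<in> S" using that by (simp add: F_def)
    then show False using S(3) pv.dependent_zero by blast
  qed
  have Sdeg: "S \<subseteq> {p. degree p \<le> n + k}" using Fdeg unfolding rpF[symmetric] by auto
  have cardS: "card S = Suc (n + k)" and finS: "finite S"
  proof -
    show "finite S" by (rule independent_bounded_degree_card(1)[OF S(3) Sdeg])
    moreover have "pv.span W \<subseteq> pv.span S" using S(4) by (rule pv.span_minimal) simp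
    ultimately have "Suc (n + k) \<le> card S" using full by (intro spanning_bounded_degree_card) auto
    then show "card S = Suc (n + k)" using independent_bounded_degree_card(2)[OF S(3) Sdeg] by simp
  qed
  have injF: "inj_on rp F" by (simp add: inj_on_def)
  have cardF: "card F = Suc (n + k)" using card_image[OF injF] rpF cardS by simp
  have finF: "finite F" using finite_image_iff[OF injF] rpF finS by simp
  have "w0 * L - L - 2 * K \<le> (\<Sum>f\<in>F. lh f) + ln (fact (Suc (n + k)))"
  proof (rule det_inequality[OF finF cardF _ _ alg])
    show "pv.independent (rp ` F)" using S(3) rpF by simp
    show "\<forall>f\<in>F. degree f \<le> n + k \<and> w0 * L - L - 2 * K \<le> lv \<xi> f"
    proof
      fix f assume f: "f \<in> F"
      obtain i b where ib: "f = monom 1 i * b" "i \<le> k" "b \<in> G" using fW[OF f] by blast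
      have "b \<noteq> 0" using F0[OF f] ib(1) by auto
      then have "lv \<xi> b - K \<le> lv \<xi> f"
        unfolding ib(1) K_def using ib(2) kn by (intro lv_monom_mult alg) auto
      then show "degree f \<le> n + k \<and> w0 * L - L - 2 * K \<le> lv \<xi> f"
        using Fdeg[OF f] G(3)[OF ib(3)] by auto
    qed
  qed
  moreover have "(\<Sum>f\<in>F. lh f) \<le> real (2 * Suc k) * L + real (m - 1) * (143 / 100 * L)"
  proof -
    define F1 where "F1 = {f\<in>F. rp f \<in> g ` {..<Suc k + Suc k}}"
    have rpF1: "rp ` F1 = g ` {..<Suc k + Suc k}" using S(1) rpF by (force simp: F1_def)
    have "card F1 = card (rp ` F1)" by (rule card_image[symmetric]) (simp add: inj_on_def)
    then have cardF1: "card F1 = 2 * Suc k" using rpF1 card_image[OF ginj] by simp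
    have F1F: "F1 \<subseteq> F" by (auto simp: F1_def)
    have "(\<Sum>f\<in>F. lh f) = (\<Sum>f\<in>F1. lh f) + (\<Sum>f\<in>F - F1. lh f)"
      using sum.subset_diff[OF F1F finF] by (simp add: add.commute)
    also have "(\<Sum>f\<in>F1. lh f) \<le> (\<Sum>f\<in>F1. L)"
    proof (rule sum_mono)
      fix f assume "f \<in> F1"
      then obtain i where i: "rp f = g i" by (auto simp: F1_def)
      have "rp f = rp (monom 1 i * P') \<or> rp f = rp (monom 1 (i - Suc k) * Q)"
        unfolding i g_def by (simp add: of_int_poly_hom.hom_mult rp_monom)
      then have "f = monom 1 i * P' \<or> f = monom 1 (i - Suc k) * Q" by simp
      then show "lh f \<le> L" using P'h by (auto simp: lh_monom_mult L_def)
    qed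
    also have "(\<Sum>f\<in>F1. L) = real (2 * Suc k) * L" by (simp only: sum_constant cardF1)
    also have "(\<Sum>f\<in>F - F1. lh f) \<le> (\<Sum>f\<in>F - F1. 143 / 100 * L)"
    proof (rule sum_mono)
      fix f assume "f \<in> F - F1"
      then obtain i b where "f = monom 1 i * b" "b \<in> G" using fW by blast
      then show "lh f \<le> 143 / 100 * L" using G(2)[of b] by (simp add: lh_monom_mult)
    qed
    also have "(\<Sum>f\<in>F - F1. 143 / 100 * L) = real (m - 1) * (143 / 100 * L)"
    proof -
      have "card (F - F1) = m - 1"
        using card_Diff_subset[OF finite_subset[OF F1F finF] F1F] cardF cardF1 kn mn by simp
      then show ?thesis by (simp only: sum_constant)
    qed
    finally show ?thesis by simp
  qed
  ultimately have "w0 * L - L \<le> real (2 * Suc k) * L + real (m - 1) * (143 / 100 * L) + L"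
    using L(4) unfolding c2_def by linarith
  then have "(w0 - 2) * L \<le> (real (2 * Suc k) + real (m - 1) * (143 / 100)) * L"
    by (simp add: algebra_simps)
  then have "w0 - 2 \<le> real (2 * Suc k) + real (m - 1) * (143 / 100)" using L(1) by simp
  moreover have "real (m - 1) = real m - 1" "real (2 * Suc k) = 2 * (real n - real m) + 2" using mn kn by auto
  ultimately have "2 * real n - d - 2 \<le> 2 * (real n - real m) + 2 + (real m - 1) * (143 / 100)"
    by (simp only: w0_def)
  \<comment> \<open>The inequality reads 0.57 m \<le> d + 2.57, while \<open>m >= 2 * d\<close>
    makes the left side at least 1.14 d.\<close>
  then show False using m(1) d by (simp add: field_simps)
qed

lemma omega_hat_le:
  assumes alg: "\<not> algebraic \<xi>" and b: "\<And>w. uniformly_approximable n \<xi> w \<Longrightarrow> w \<le> b"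
  shows "omega_hat n \<xi> \<le> ereal b"
  unfolding omega_hat_def
proof (rule Sup_least, clarify)
  fix w :: real
  assume ev: "\<forall>\<^sub>F H in at_top. \<exists>P\<in>int_polys_upto n. poly_height (rp P) \<le> H \<and>
     0 < \<bar>poly (rp P) \<xi>\<bar> \<and> \<bar>poly (rp P) \<xi>\<bar> \<le> H powr - w"
  then obtain H0 where H0: "\<And>H. H \<ge> H0 \<Longrightarrow> \<exists>P\<in>int_polys_upto n. poly_height (rp P) \<le> H \<and>
     0 < \<bar>poly (rp P) \<xi>\<bar> \<and> \<bar>poly (rp P) \<xi>\<bar> \<le> H powr - w"
    unfolding eventually_at_top_linorder by blast
  \<comment> \<open>The maximum with 1 keeps the logarithm meaningful when \<open>H0\<close> is not
    positive.\<close>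
  have "\<exists>R. R \<noteq> 0 \<and> degree R \<le> n \<and> lh R \<le> Y \<and> w * Y \<le> lv \<xi> R" if Y: "Y \<ge> ln (max 1 H0)" for Y
  proof -
    have "max 1 H0 = exp (ln (max 1 H0))" by (rule exp_ln[symmetric]) simp
    also have "\<dots> \<le> exp Y" using Y by (simp only: exp_le_cancel_iff)
    finally have "max 1 H0 \<le> exp Y" .
    then obtain P where P: "P \<in> int_polys_upto n" "poly_height (rp P) \<le> exp Y"
      "0 < \<bar>poly (rp P) \<xi>\<bar>" "\<bar>poly (rp P) \<xi>\<bar> \<le> exp Y powr - w" using H0[of "exp Y"] by auto
    have P0: "P \<noteq> 0" using P(3) by auto
    have "exp (- lv \<xi> P) \<le> exp (- (w * Y))"
      using P(4) abs_eval_eq_exp[OF alg P0] by (simp add: powr_def)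
    moreover have "exp (lh P) \<le> exp Y" using P(2) height_eq_exp_lh[OF P0] by simp
    ultimately show ?thesis using P0 P(1) by (intro exI[of _ P]) (auto simp: int_polys_upto_def)
  qed
  then have "uniformly_approximable n \<xi> w" unfolding uniformly_approximable_def by blast
  then show "ereal w \<le> ereal b" using b by simp
qed

section \<open>The constants\<close>

text \<open>Lagrange remainder of order 6, with the exponential at the intermediate point at most 2,
  so that 2/6! = 1/360.\<close>

lemma exp_taylor_bounds:
  fixes x :: real
  assumes "0 \<le> x" "x \<le> 1/2"
  shows "(\<Sum>k<6. x ^ k / fact k) \<le> exp x" "exp x \<le> (\<Sum>k<6. x ^ k / fact k) + x ^ 6 / 360"
proof -
  obtain t where t: "\<bar>t\<bar> \<le> \<bar>x\<bar>" "exp x = (\<Sum>k<6. x ^ k / fact k) + exp t / fact 6 * x ^ 6"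
    using Maclaurin_exp_le[of x 6] by blast
  have "exp t \<le> exp (1/2)" using t(1) assms by simp
  also have "\<dots> \<le> 1 + 1/2 + (1/2)\<^sup>2" by (rule exp_bound) auto
  also have "\<dots> \<le> (2::real)" by (simp add: power2_eq_square)
  finally have "exp t / fact 6 * x ^ 6 \<le> 2 / fact 6 * x ^ 6"
    using assms by (intro mult_right_mono divide_right_mono) auto
  moreover have "2 / fact 6 * x ^ 6 = x ^ 6 / 360" by (simp add: fact_numeral)
  moreover have "0 \<le> exp t / fact 6 * x ^ 6" using assms by simp
  ultimately show "(\<Sum>k<6. x ^ k / fact k) \<le> exp x" "exp x \<le> (\<Sum>k<6. x ^ k / fact k) + x ^ 6 / 360"
    using t(2) by linarith+
qed

lemma eps_equation_strict_mono:
  fixes x y :: real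
  assumes "0 < x" "x < y"
  shows "(1 + x) * exp x < (1 + y) * exp y"
  using assms by (intro mult_strict_mono) auto

lemma eps_equation_at_lower: "(1 + 0.3748) * exp (0.3748::real) < 2"
proof -
  have "exp (0.3748::real) \<le> (\<Sum>k<6. 0.3748 ^ k / fact k) + 0.3748 ^ 6 / 360"
    by (rule exp_taylor_bounds) auto
  also have "\<dots> \<le> 1.45472" by (simp add: eval_nat_numeral fact_numeral)
  finally show ?thesis by simp
qed

lemma eps_equation_at_upper: "2 < (1 + 0.37484) * exp (0.37484::real)"
proof -
  have "1.45475 \<le> (\<Sum>k<6. (0.37484::real) ^ k / fact k)" by (simp add: eval_nat_numeral fact_numeral)
  also have "\<dots> \<le> exp (0.37484::real)" by (rule exp_taylor_bounds) auto
  finally show ?thesis by simp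
qed

text \<open>Intermediate value theorem between two numerical evaluations, and strict monotonicity
  for uniqueness. The upper end 0.37484 is sharper than 0.3749 because the upper bound for
  \<open>a_const\<close> needs it.\<close>

lemma eps_const_unique: "\<exists>!x::real. x > 0 \<and> (1 + x) * exp x = 2"
  and eps_const_bounds: "0.3748 \<le> eps_const" "eps_const \<le> 0.37484"
  and eps_const_equation: "(1 + eps_const) * exp eps_const = 2"
proof -
  have "\<exists>x\<ge>0.3748. x \<le> 0.37484 \<and> (1 + x) * exp x = (2::real)"
    by (rule IVT') (use eps_equation_at_lower eps_equation_at_upper in \<open>auto intro!: continuous_intros\<close>)
  then obtain x :: real where x: "0.3748 \<le> x" "x \<le> 0.37484" "(1 + x) * exp x = 2" by blast
  have x0: "x > 0" using x by simp
  have uniq: "y = x" if "y > 0 \<and> (1 + y) * exp y = 2" for y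
  proof (rule ccontr)
    assume "y \<noteq> x"
    then have "x < y \<or> y < x" by linarith
    then show False
      using eps_equation_strict_mono[of x y] eps_equation_strict_mono[of y x] that x(3) x0 by linarith
  qed
  show "\<exists>!x::real. x > 0 \<and> (1 + x) * exp x = 2" using x(3) x0 uniq by blast
  have "eps_const = x" unfolding eps_const_def by (rule the_equality; use x(3) x0 uniq in blast)
  then show "0.3748 \<le> eps_const" "eps_const \<le> 0.37484" "(1 + eps_const) * exp eps_const = 2"
    using x by auto
qed

text \<open>The equation for \<epsilon> gives exp \<epsilon> = 2/(1 + \<epsilon>), which turns the
  cube of \<open>a_const\<close> into the rational expression 4 \<epsilon>^2 / (9 (1 +
  \<epsilon>)).\<close>

lemma a_const_bounds: "0.3567 \<le> a_const" "a_const < 0.3568"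
proof -
  define e where "e = eps_const"
  have e: "0.3748 \<le> e" "e \<le> 0.37484" "(1 + e) * exp e = 2"
    using eps_const_bounds eps_const_equation by (auto simp: e_def)
  have e0: "1 + e \<noteq> 0" using e(1) by simp
  have "exp e = 2 / (1 + e)" using e(3) e0 by (simp add: nonzero_eq_divide_eq mult.commute)
  then have "2 * e * (2 - exp e) / 9 = 2 * e * (2 - 2 / (1 + e)) / 9" by simp
  also have "\<dots> = 4 * e\<^sup>2 / (9 * (1 + e))" using e0 by (simp add: divide_simps power2_eq_square)
  finally have a: "a_const = (4 * e\<^sup>2 / (9 * (1 + e))) powr (1/3)"
    unfolding a_const_def e_def[symmetric] by (simp only:)
  have cube: "(z ^ 3) powr (1/3) = z" if "z > 0" for z :: real
  proof -
    have "(z ^ 3) powr (1/3) = (z powr 3) powr (1/3)" using that by (simp only: powr_numeral)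
    also have "\<dots> = z powr (3 * (1/3))" by (rule powr_powr)
    also have "\<dots> = z" using that by simp
    finally show ?thesis .
  qed
  have "0.3748\<^sup>2 \<le> e\<^sup>2" by (rule power_mono) (use e(1) in simp_all)
  moreover have "e\<^sup>2 \<le> 0.37484\<^sup>2" by (rule power_mono) (use e(1,2) in simp_all)
  ultimately have sq: "0.3748\<^sup>2 \<le> e\<^sup>2" "e\<^sup>2 \<le> 0.37484\<^sup>2" by blast+
  have lo: "0.3567 ^ 3 \<le> 4 * e\<^sup>2 / (9 * (1 + e))" using sq e(1,2) by (simp add: field_simps power2_eq_square power3_eq_cube)
  have hi: "4 * e\<^sup>2 / (9 * (1 + e)) < 0.3568 ^ 3" using sq e(1,2) by (simp add: field_simps power2_eq_square power3_eq_cube)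
  have "(0.3567 ^ 3) powr (1/3) \<le> a_const" unfolding a using lo by (intro powr_mono2) auto
  then show "0.3567 \<le> a_const" by (subst (asm) cube) auto
  have "a_const < (0.3568 ^ 3) powr (1/3)" unfolding a using hi lo e by (intro powr_less_mono2) auto
  then show "a_const < 0.3568" by (subst (asm) cube) auto
qed

theorem theorem11p1:
  shows "(\<exists>!x::real. x > 0 \<and> (1 + x) * exp x = 2) \<and>
    0.3748 \<le> eps_const \<and> eps_const < 0.3749 \<and>
    0.3567 \<le> a_const \<and> a_const < 0.3568 \<and>
    (\<exists>C::real. C > 0 \<and>
      (\<forall>(n::nat) (\<xi>::real). n \<ge> 1 \<longrightarrow> \<not> algebraic \<xi> \<longrightarrow>
        omega_hat n \<xi> \<le> ereal (2 * real n - a_const * real n powr (1/3) + C)))"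
proof (intro conjI exI[of _ "1000::real"] allI impI)
  show "\<exists>!x::real. x > 0 \<and> (1 + x) * exp x = 2" by (rule eps_const_unique)
  show "0.3748 \<le> eps_const" "0.3567 \<le> a_const" "a_const < 0.3568" by (fact eps_const_bounds a_const_bounds)+
  show "eps_const < 0.3749" using eps_const_bounds(2) by simp
  fix n :: nat and \<xi> :: real
  assume n: "n \<ge> 1" and alg: "\<not> algebraic \<xi>"
  define d where "d = a_const * real n powr (1/3)"
  show "omega_hat n \<xi> \<le> ereal (2 * real n - a_const * real n powr (1/3) + 1000)"
    unfolding d_def[symmetric]
  proof (rule omega_hat_le[OF alg])
    fix w assume w: "uniformly_approximable n \<xi> w"
    show "w \<le> 2 * real n - d + 1000"
    \<comment> \<open>The constant 1000 is the threshold for \<open>d\<close> in the main argument;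
      below it, \<open>w <= 2 * n\<close> already suffices.\<close>
    proof (cases "d \<ge> 1000")
      case True
      have "(real n powr (1/3)) ^ 3 = (real n powr (1/3)) powr 3" by (subst powr_numeral) (use n in simp_all)
      also have "\<dots> = real n powr (1/3 * 3)" by (rule powr_powr)
      finally have "(real n powr (1/3)) ^ 3 = real n" using n by simp
      then have "22 * d ^ 3 = (22 * a_const ^ 3) * real n" by (simp add: d_def power_mult_distrib)
      also have "\<dots> \<le> (22 * 0.3568 ^ 3) * real n"
        using a_const_bounds by (intro mult_right_mono mult_left_mono power_mono) auto
      \<comment> \<open>Here 22 times 0.3568^3 is just below 1.\<close>
      also have "\<dots> \<le> 1 * real n" by (intro mult_right_mono) (auto simp: power3_eq_cube)
      finally have "22 * d ^ 3 \<le> real n" by simp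
      then have "w \<le> 2 * real n - d" by (rule exponent_le_2n_minus_d[OF alg w _ True])
      then show ?thesis by simp
    next
      case False
      then show ?thesis using exponent_le_2n[OF alg w] by simp
    qed
  qed
qed simp

end
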